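(* Let $E$ be an $\mathscr{L}_\infty$-Banach space, let $E^\ast$ be its Banach space dual, and let $\tau_k(E)$ denote the topology on $E^\ast$ of uniform convergence on compact subsets of $E$. Then there is a cardinal $\kappa$ such that the additive topological group $\widehat{E}=(E^\ast,\tau_k(E))$ is topologically isomorphic to a subgroup of the additive group of the power $(\ell_1)^\kappa$ (with the product topology, each factor carrying its norm topology), and hence $(E^\ast,\tau_k(E))$ is unitarily representable.
   Context: A topological group is called unitarily representable if it is topologically isomorphic to a subgroup of the unitary group $\mathcal{U}(\mathbb{H})$ of some Hilbert space $\mathbb{H}$ (of arbitrary dimension), where $\mathcal{U}(\mathbb{H})$ carries the strong operator topology. A Banach space $E$ is an $\mathscr{L}_\infty$-space if there is $\lambda\ge 1$ such that every finite-dimensional subspace $F$ of $E$ is contained in a finite-dimensional subspace $G$ of $E$ whose Banach–Mazur distance to $\ell_\infty^{m}$, $m=\dim G$, is at most $\lambda$. The compact subsets of $E$ are taken with respect to the norm topology. *)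

theory Defs
  imports "HOL-Analysis.Analysis" "HOL-Algebra.Module" "HOL-Algebra.Bij"
    "HOL-Algebra.Product_Groups"
begin

section \<open>\<open>\<L>\<^sub>\<infinity>\<close>-spaces\<close>

text \<open>The operator norm of the restriction of \<open>T\<close> to a subspace \<open>V\<close>; it is \<open>\<infinity>\<close> if that restriction
  is unbounded.\<close>

definition opnorm_on :: "'a::real_normed_vector set \<Rightarrow> ('a \<Rightarrow> 'b::real_normed_vector) \<Rightarrow> ereal" where
  "opnorm_on V T = (SUP x\<in>{x \<in> V. norm x \<le> 1}. ereal (norm (T x)))"

text \<open>The (multiplicative) Banach--Mazur distance of two linear subspaces. Asking \<open>T\<close> to be linear on
  the whole type is no restriction, since a linear map on a subspace always has a linear extension.
  The distance of non-isomorphic subspaces is \<open>Inf {} = \<infinity>\<close>.\<close>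

definition banach_mazur_dist ::
    "'a::real_normed_vector set \<Rightarrow> 'b::real_normed_vector set \<Rightarrow> ereal" where
  "banach_mazur_dist V W =
     (INF T\<in>{T. linear T \<and> bij_betw T V W}. opnorm_on V T * opnorm_on W (inv_into V T))"

text \<open>The type \<open>nat \<Rightarrow>\<^sub>C real\<close> is the space of bounded real sequences with the supremum norm
  (\<open>nat\<close> is discrete), and \<open>\<ell>\<^sub>\<infinity>\<^sup>m\<close> is its subspace of sequences supported in \<open>{..<m}\<close>.\<close>

definition linf_fin :: "nat \<Rightarrow> (nat \<Rightarrow>\<^sub>C real) set" where
  "linf_fin m = {x. \<forall>i\<ge>m. apply_bcontfun x i = 0}"

definition fin_dim_subspace :: "'a::real_vector set \<Rightarrow> bool" where
  "fin_dim_subspace F \<longleftrightarrow> subspace F \<and> (\<exists>B. finite B \<and> span B = F)"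

definition script_L_infty :: "'a::real_normed_vector itself \<Rightarrow> bool" where
  "script_L_infty (_ :: 'a itself) \<longleftrightarrow>
     (\<exists>l::real. l \<ge> 1 \<and>
       (\<forall>F :: 'a set. fin_dim_subspace F \<longrightarrow>
         (\<exists>G. fin_dim_subspace G \<and> F \<subseteq> G \<and> banach_mazur_dist G (linf_fin (dim G)) \<le> ereal l)))"


section \<open>The topology of uniform convergence on compact sets\<close>

definition tau_k :: "('a::real_normed_vector \<Rightarrow>\<^sub>L real) topology" where
  "tau_k = topology (\<lambda>U. \<forall>f\<in>U. \<exists>K e. compact K \<and> e > 0 \<and>
     {g. \<forall>x\<in>K. \<bar>blinfun_apply g x - blinfun_apply f x\<bar> < e} \<subseteq> U)"

lemma openin_tau_k:
  "openin tau_k U \<longleftrightarrow> (\<forall>f\<in>U. \<exists>K e. compact K \<and> e > 0 \<and>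
     {g. \<forall>x\<in>K. \<bar>blinfun_apply g x - blinfun_apply f x\<bar> < e} \<subseteq> U)"
proof -
  define P where "P = (\<lambda>U :: ('a \<Rightarrow>\<^sub>L real) set. \<forall>f\<in>U. \<exists>K e. compact K \<and> e > 0 \<and>
     {g. \<forall>x\<in>K. \<bar>blinfun_apply g x - blinfun_apply f x\<bar> < e} \<subseteq> U)"
  have "P (S \<inter> T)" if S: "P S" and T: "P T" for S T
    unfolding P_def
  proof
    fix f assume f: "f \<in> S \<inter> T"
    obtain K1 e1 where 1: "compact K1" "e1 > 0"
      "{g. \<forall>x\<in>K1. \<bar>blinfun_apply g x - blinfun_apply f x\<bar> < e1} \<subseteq> S"
      using S f unfolding P_def by blast
    obtain K2 e2 where 2: "compact K2" "e2 > 0"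
      "{g. \<forall>x\<in>K2. \<bar>blinfun_apply g x - blinfun_apply f x\<bar> < e2} \<subseteq> T"
      using T f unfolding P_def by blast
    have "{g. \<forall>x\<in>K1 \<union> K2. \<bar>blinfun_apply g x - blinfun_apply f x\<bar> < min e1 e2} \<subseteq> S \<inter> T"
      using 1 2 by auto
    moreover have "compact (K1 \<union> K2)" "min e1 e2 > 0"
      using 1 2 by auto
    ultimately show "\<exists>K e. compact K \<and> e > 0 \<and>
        {g. \<forall>x\<in>K. \<bar>blinfun_apply g x - blinfun_apply f x\<bar> < e} \<subseteq> S \<inter> T"
      by blast
  qed
  moreover have "P (\<Union>\<K>)" if "\<forall>S\<in>\<K>. P S" for \<K>
    unfolding P_def
  proof
    fix f assume "f \<in> \<Union>\<K>"
    then obtain S where S: "S \<in> \<K>" "f \<in> S" by blast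
    moreover from S that have "P S" by blast
    ultimately obtain K e where "compact K" "e > 0"
      "{g. \<forall>x\<in>K. \<bar>blinfun_apply g x - blinfun_apply f x\<bar> < e} \<subseteq> S"
      unfolding P_def by blast
    then show "\<exists>K e. compact K \<and> e > 0 \<and>
        {g. \<forall>x\<in>K. \<bar>blinfun_apply g x - blinfun_apply f x\<bar> < e} \<subseteq> \<Union>\<K>"
      using S by blast
  qed
  ultimately have "istopology P"
    unfolding istopology_def by simp
  then show ?thesis
    unfolding tau_k_def P_def[symmetric] by (simp add: topology_inverse' P_def)
qed

lemma topspace_tau_k [simp]: "topspace tau_k = UNIV"
proof -
  have "openin tau_k (UNIV :: ('a \<Rightarrow>\<^sub>L real) set)"
    unfolding openin_tau_k by (auto intro: exI[of _ "{}"] exI[of _ 1])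
  then show ?thesis
    using openin_subset[of tau_k UNIV] by (simp add: top.extremum_unique)
qed


section \<open>The Banach space \<open>\<ell>\<^sub>1\<close>\<close>

typedef ell1 = "{x :: nat \<Rightarrow> real. summable (\<lambda>n. \<bar>x n\<bar>)}"
  morphisms ell1_nth Abs_ell1
  by (rule exI[of _ "\<lambda>_. 0"]) simp

setup_lifting type_definition_ell1

lemma summable_ell1: "summable (\<lambda>n. \<bar>ell1_nth x n\<bar>)"
  using ell1_nth[of x] by simp

lemma summable_abs_add:
  fixes x y :: "nat \<Rightarrow> real"
  assumes "summable (\<lambda>n. \<bar>x n\<bar>)" "summable (\<lambda>n. \<bar>y n\<bar>)"
  shows "summable (\<lambda>n. \<bar>x n + y n\<bar>)"
  by (rule summable_comparison_test'[OF summable_add[OF assms], of 0]) simp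

instantiation ell1 :: real_normed_vector
begin

lift_definition zero_ell1 :: ell1 is "\<lambda>_. 0" by simp

lift_definition plus_ell1 :: "ell1 \<Rightarrow> ell1 \<Rightarrow> ell1" is "\<lambda>x y n. x n + y n"
  by (rule summable_abs_add)

lift_definition uminus_ell1 :: "ell1 \<Rightarrow> ell1" is "\<lambda>x n. - x n" by simp

lift_definition minus_ell1 :: "ell1 \<Rightarrow> ell1 \<Rightarrow> ell1" is "\<lambda>x y n. x n - y n"
proof -
  fix x y :: "nat \<Rightarrow> real"
  assume "summable (\<lambda>n. \<bar>x n\<bar>)" "summable (\<lambda>n. \<bar>y n\<bar>)"
  then show "summable (\<lambda>n. \<bar>x n - y n\<bar>)"
    using summable_abs_add[of x "\<lambda>n. - y n"] by simp
qed

lift_definition scaleR_ell1 :: "real \<Rightarrow> ell1 \<Rightarrow> ell1" is "\<lambda>c x n. c * x n"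
  by (simp add: abs_mult summable_mult)

lift_definition norm_ell1 :: "ell1 \<Rightarrow> real" is "\<lambda>x. \<Sum>n. \<bar>x n\<bar>" .

definition dist_ell1 :: "ell1 \<Rightarrow> ell1 \<Rightarrow> real" where
  "dist_ell1 x y = norm (x - y)"

definition sgn_ell1 :: "ell1 \<Rightarrow> ell1" where
  "sgn_ell1 x = inverse (norm x) *\<^sub>R x"

definition uniformity_ell1 :: "(ell1 \<times> ell1) filter" where
  "uniformity_ell1 = (INF e\<in>{0 <..}. principal {(x, y). dist x y < e})"

definition open_ell1 :: "ell1 set \<Rightarrow> bool" where
  "open_ell1 U = (\<forall>x\<in>U. \<forall>\<^sub>F (x', y) in uniformity. x' = x \<longrightarrow> y \<in> U)"

instance
proof
  fix x y z :: ell1 and a b :: real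
  show "x + y + z = x + (y + z)" by transfer (simp add: add.assoc)
  show "x + y = y + x" by transfer (simp add: add.commute)
  show "0 + x = x" by transfer simp
  show "- x + x = 0" by transfer simp
  show "x - y = x + - y" by transfer simp
  show "a *\<^sub>R (x + y) = a *\<^sub>R x + a *\<^sub>R y" by transfer (simp add: algebra_simps)
  show "(a + b) *\<^sub>R x = a *\<^sub>R x + b *\<^sub>R x" by transfer (simp add: algebra_simps)
  show "a *\<^sub>R b *\<^sub>R x = (a * b) *\<^sub>R x" by transfer (simp add: algebra_simps)
  show "1 *\<^sub>R x = x" by transfer simp
  show "dist x y = norm (x - y)" by (rule dist_ell1_def)
  show "sgn x = inverse (norm x) *\<^sub>R x" by (rule sgn_ell1_def)
  show "uniformity = (INF e\<in>{0 <..}. principal {(x, y). dist (x::ell1) y < e})"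
    by (rule uniformity_ell1_def)
  show "open U \<longleftrightarrow> (\<forall>x\<in>U. \<forall>\<^sub>F (x', y) in uniformity. x' = x \<longrightarrow> y \<in> U)" for U :: "ell1 set"
    by (rule open_ell1_def)
  show "norm x = 0 \<longleftrightarrow> x = 0"
    by transfer (auto simp: suminf_eq_zero_iff)
  show "norm (x + y) \<le> norm x + norm y"
  proof transfer
    fix x y :: "nat \<Rightarrow> real"
    assume s: "summable (\<lambda>n. \<bar>x n\<bar>)" "summable (\<lambda>n. \<bar>y n\<bar>)"
    have "(\<Sum>n. \<bar>x n + y n\<bar>) \<le> (\<Sum>n. \<bar>x n\<bar> + \<bar>y n\<bar>)"
      by (rule suminf_le[OF abs_triangle_ineq summable_abs_add[OF s] summable_add[OF s]])
    also have "\<dots> = (\<Sum>n. \<bar>x n\<bar>) + (\<Sum>n. \<bar>y n\<bar>)"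
      by (rule suminf_add[OF s, symmetric])
    finally show "(\<Sum>n. \<bar>x n + y n\<bar>) \<le> (\<Sum>n. \<bar>x n\<bar>) + (\<Sum>n. \<bar>y n\<bar>)" .
  qed
  show "norm (a *\<^sub>R x) = \<bar>a\<bar> * norm x"
    by transfer (simp add: abs_mult suminf_mult)
qed

end


section \<open>Topological isomorphism onto a subgroup\<close>

definition additive_group :: "'g::ab_group_add monoid" where
  "additive_group = \<lparr>carrier = UNIV, mult = (+), one = 0\<rparr>"

lemma group_additive_group: "group additive_group"
  unfolding additive_group_def
proof (rule groupI)
  fix x :: 'a
  show "\<exists>y\<in>carrier \<lparr>carrier = UNIV, mult = (+), one = 0\<rparr>.
      y \<otimes>\<^bsub>\<lparr>carrier = UNIV, mult = (+), one = 0\<rparr>\<^esub> x = \<one>\<^bsub>\<lparr>carrier = UNIV, mult = (+), one = 0\<rparr>\<^esub>"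
    by (rule bexI[of _ "- x"]) simp_all
qed (simp_all add: add.assoc)

definition topologically_isomorphic ::
    "'g monoid \<Rightarrow> 'g topology \<Rightarrow> 'h monoid \<Rightarrow> 'h topology \<Rightarrow> bool" where
  "topologically_isomorphic G TG H TH \<longleftrightarrow> (\<exists>\<phi>\<in>iso G H. homeomorphic_map TG TH \<phi>)"

definition isomorphic_to_subgroup_of ::
    "'g monoid \<Rightarrow> 'g topology \<Rightarrow> 'h monoid \<Rightarrow> 'h topology \<Rightarrow> bool" where
  "isomorphic_to_subgroup_of G TG H TH \<longleftrightarrow>
     (\<exists>S. subgroup S H \<and>
        topologically_isomorphic G TG (H\<lparr>carrier := S\<rparr>) (subtopology TH S))"


section \<open>Hilbert spaces and their unitary groups\<close>

definition complex_ring :: "complex ring" where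
  "complex_ring = \<lparr>carrier = UNIV, mult = (*), one = 1, zero = 0, add = (+)\<rparr>"

record 'h inner_space = "(complex, 'h) module" +
  ip :: "'h \<Rightarrow> 'h \<Rightarrow> complex"

text \<open>The distance is set to 0 off the carrier because \<^locale>\<open>Metric_space\<close> asks for symmetry and
  nonnegativity on the whole type.\<close>

definition hdist :: "'h inner_space \<Rightarrow> 'h \<Rightarrow> 'h \<Rightarrow> real" where
  "hdist H x y =
     (if x \<in> carrier H \<and> y \<in> carrier H
      then sqrt (Re (ip H (x \<ominus>\<^bsub>H\<^esub> y) (x \<ominus>\<^bsub>H\<^esub> y))) else 0)"

text \<open>Only the additive part of the record \<open>H\<close> is used; its fields \<open>mult\<close> and \<open>one\<close> are
  irrelevant.\<close>

locale pre_hilbert_space = Module.module complex_ring H for H :: "'h inner_space" (structure) +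
  assumes ip_add: "\<lbrakk>x \<in> carrier H; y \<in> carrier H; z \<in> carrier H\<rbrakk> \<Longrightarrow>
        ip H (x \<oplus> y) z = ip H x z + ip H y z"
    and ip_scale: "\<lbrakk>x \<in> carrier H; y \<in> carrier H\<rbrakk> \<Longrightarrow> ip H (a \<odot> x) y = a * ip H x y"
    and ip_cnj: "\<lbrakk>x \<in> carrier H; y \<in> carrier H\<rbrakk> \<Longrightarrow> ip H y x = cnj (ip H x y)"
    and ip_nonneg: "x \<in> carrier H \<Longrightarrow> 0 \<le> Re (ip H x x)"
    and ip_definite: "\<lbrakk>x \<in> carrier H; ip H x x = 0\<rbrakk> \<Longrightarrow> x = \<zero>"

locale hilbert_space = pre_hilbert_space +
  assumes complete: "Metric_space.mcomplete (carrier H) (hdist H)"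

definition hilbert_topology :: "'h inner_space \<Rightarrow> 'h topology" where
  "hilbert_topology H = Metric_space.mtopology (carrier H) (hdist H)"

definition unitary_group :: "'h inner_space \<Rightarrow> ('h \<Rightarrow> 'h) monoid" where
  "unitary_group H = BijGroup (carrier H)
     \<lparr>carrier := {U \<in> Bij (carrier H).
        (\<forall>x\<in>carrier H. \<forall>y\<in>carrier H. U (x \<oplus>\<^bsub>H\<^esub> y) = U x \<oplus>\<^bsub>H\<^esub> U y) \<and>
        (\<forall>a. \<forall>x\<in>carrier H. U (a \<odot>\<^bsub>H\<^esub> x) = a \<odot>\<^bsub>H\<^esub> U x) \<and>
        (\<forall>x\<in>carrier H. \<forall>y\<in>carrier H. ip H (U x) (U y) = ip H x y)}\<rparr>"

text \<open>The strong operator topology is the topology of pointwise convergence on \<open>H\<close>, each value being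
  taken in the norm topology. Elements of \<^const>\<open>unitary_group\<close> are extensional functions, hence
  points of the product space.\<close>

definition strong_topology :: "'h inner_space \<Rightarrow> ('h \<Rightarrow> 'h) topology" where
  "strong_topology H =
     subtopology (product_topology (\<lambda>_. hilbert_topology H) (carrier H)) (carrier (unitary_group H))"

text \<open>HOL cannot quantify over the type carrying the Hilbert space, so that type is fixed to
  \<open>'g set \<times> 'g \<Rightarrow> complex\<close>; the carrier \<open>H\<close> is an arbitrary subset of it with arbitrary operations.
  This loses nothing. Suppose \<open>G\<close> embeds into the unitary group of some Hilbert space, with \<open>G\<close>
  infinite (a finite \<open>G\<close> has its regular representation). For every neighbourhood of the
  identity finitely many vectors witness that it contains a basic neighbourhood of the topology
  induced by the strong operator topology. The closed invariant subspace generated by all these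
  vectors still gives an embedding. Its dimension is at most the cardinality of \<open>'g set \<times> 'g\<close>, so it is
  isomorphic to a space of square-summable functions on a subset of \<open>'g set \<times> 'g\<close>.\<close>

definition unitarily_representable :: "'g monoid \<Rightarrow> 'g topology \<Rightarrow> bool" where
  "unitarily_representable G TG \<longleftrightarrow>
     (\<exists>H :: ('g set \<times> 'g \<Rightarrow> complex) inner_space. hilbert_space H \<and>
        isomorphic_to_subgroup_of G TG (unitary_group H) (strong_topology H))"

end

theory Submission
  imports Defs
begin

text \<open>
  Let \<open>E\<close> be an \<open>\<L>\<^sub>\<infinity>\<close>-space. The key point is that every compact set \<open>K\<close> in \<open>E\<close> lies in the image of a ball
  under a compact operator from \<open>c\<^sub>0\<close> to \<open>E\<close>: a point of \<open>K\<close> is a fast converging series of differences taken from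
  finite sets, each finite set lies in a uniformly well-behaved copy of some \<open>\<ell>\<^sub>\<infinity>\<^sup>m\<close>, and the inclusions of these
  copies, weighted by null factors, add up to the operator. The operator is given by the images \<open>z n\<close> of the
  unit vectors. Its adjoint \<open>f \<mapsto> (f (z n))\<^sub>n\<close> maps \<open>E\<^sup>*\<close> to \<open>\<ell>\<^sub>1\<close>; it is continuous for the topology of uniform
  convergence on compact sets, and its norm dominates the supremum of \<open>\<bar>f\<bar>\<close> over \<open>K\<close>. This is
  \<open>compact_dominated_by_summing_sequence\<close>. The product of these adjoints over all compact sets is the embedding into
  a power of \<open>\<ell>\<^sub>1\<close>.

  For the unitary representation, the function \<open>exp (- \<parallel>x\<parallel>)\<close> on \<open>\<ell>\<^sub>1\<close> is positive definite. Indeed, multiplying a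
  positive definite kernel by a triangle function of \<open>h x - h y\<close> keeps it positive definite, since such a function
  is an integral of products of indicators; powers of triangle functions converge to \<open>exp (- \<bar>h x - h y\<bar>)\<close>, and the
  coordinates of \<open>\<ell>\<^sub>1\<close> can be treated one after the other (\<open>pos_def_exp_suminf\<close>). Composing with the adjoints above
  gives, for each compact set, a continuous positive definite function on \<open>E\<^sup>*\<close> that is close to 1 only at
  functionals that are small on the compact set.

  The corresponding cyclic representations and their orthogonal sum are obtained in one step as the reproducing
  kernel Hilbert space of a kernel on pairs of an index and a functional, on which \<open>E\<^sup>*\<close> acts by translation. This
  also answers the question on which type the Hilbert space lives: it is a space of complex functions on such pairs,
  and polars of compact sets can be used as indices.
\<close>

section \<open>Compact subsets of \<open>\<L>\<^sub>\<infinity>\<close>-spaces\<close>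

definition unit_seq :: "nat \<Rightarrow> nat \<Rightarrow>\<^sub>C real" where
  "unit_seq i = Bcontfun (\<lambda>j. of_bool (j = i))"

lemma apply_unit_seq: "apply_bcontfun (unit_seq i) j = of_bool (j = i)"
proof -
  have "(\<lambda>j. of_bool (j = i) :: real) \<in> bcontfun"
    by (rule bcontfun_normI[of _ 1]) auto
  then show ?thesis by (simp add: unit_seq_def Bcontfun_inverse)
qed

lemma apply_bcontfun_sum: "apply_bcontfun (\<Sum>i\<in>A. f i) j = (\<Sum>i\<in>A. apply_bcontfun (f i) j)"
  by (induction A rule: infinite_finite_induct) (auto simp: plus_bcontfun.rep_eq zero_bcontfun.rep_eq)

lemma apply_comb: "apply_bcontfun (\<Sum>i<m. s i *\<^sub>R unit_seq i) j = (if j < m then s j else 0)"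
  by (simp add: apply_bcontfun_sum apply_unit_seq if_distrib cong: if_cong)

lemma linf_fin_expand:
  assumes "x \<in> linf_fin m" shows "x = (\<Sum>i<m. apply_bcontfun x i *\<^sub>R unit_seq i)"
proof (rule bcontfun_eqI)
  fix j show "apply_bcontfun x j = apply_bcontfun (\<Sum>i<m. apply_bcontfun x i *\<^sub>R unit_seq i) j"
    using assms by (auto simp: apply_comb linf_fin_def not_less)
qed

lemma comb_in_linf_fin: "(\<Sum>i<m. s i *\<^sub>R unit_seq i) \<in> linf_fin m"
  by (auto simp: linf_fin_def apply_comb)

lemma norm_comb_le:
  assumes "\<And>i. i < m \<Longrightarrow> \<bar>s i\<bar> \<le> 1" shows "norm (\<Sum>i<m. s i *\<^sub>R unit_seq i) \<le> 1"
  using assms by (intro norm_bound) (simp add: apply_comb)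

lemma subspace_linf_fin: "subspace (linf_fin m)"
  by (auto simp: subspace_def linf_fin_def plus_bcontfun.rep_eq zero_bcontfun.rep_eq)

text \<open>Only homogeneity on \<open>V\<close> is asked of \<open>T\<close>, because the lemma is also applied to the inverse
  \<^const>\<open>inv_into\<close> of a Banach--Mazur isomorphism, which is arbitrary off its domain.\<close>

lemma opnorm_on_le:
  assumes "subspace V" "x \<in> V" and T: "\<And>c x. x \<in> V \<Longrightarrow> T (c *\<^sub>R x) = c *\<^sub>R T x"
    and "opnorm_on V T \<le> ereal a"
  shows "norm (T x) \<le> a * norm x"
proof (cases "x = 0")
  case True
  then show ?thesis using T[OF assms(2), of 0] by simp
next
  case False
  let ?y = "(1 / norm x) *\<^sub>R x"
  have "?y \<in> V" "norm ?y \<le> 1"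
    using assms False by (auto intro: subspace_scale)
  then have "ereal (norm (T ?y)) \<le> opnorm_on V T"
    unfolding opnorm_on_def by (intro SUP_upper) auto
  then have "norm (T ?y) \<le> a" using assms(4) by (metis ereal_less_eq(3) order_trans)
  then show ?thesis using T[OF assms(2)] False by (simp add: field_simps)
qed

text \<open>The unit vectors of \<open>\<ell>\<^sub>\<infinity>\<^sup>m\<close> can be sent to \<open>y 0, \<dots>, y (m - 1)\<close> by a contraction, and under it each
  \<open>x \<in> A\<close> has a preimage of norm at most \<open>C * norm x\<close>. This is all that is needed from a nearly
  isometric copy of \<open>\<ell>\<^sub>\<infinity>\<^sup>m\<close> around \<open>A\<close>.\<close>

definition linf_frame :: "real \<Rightarrow> 'a::real_normed_vector set \<Rightarrow> nat \<Rightarrow> (nat \<Rightarrow> 'a) \<Rightarrow> bool" where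
  "linf_frame C A m y \<longleftrightarrow>
     (\<forall>s. (\<forall>i<m. \<bar>s i\<bar> \<le> 1) \<longrightarrow> norm (\<Sum>i<m. s i *\<^sub>R y i) \<le> 1) \<and>
     (\<forall>x\<in>A. \<exists>u. x = (\<Sum>i<m. u i *\<^sub>R y i) \<and> (\<forall>i<m. \<bar>u i\<bar> \<le> C * norm x))"

text \<open>Take an isomorphism \<open>T\<close> of a space \<open>G\<close> containing \<open>A\<close> onto \<open>\<ell>\<^sub>\<infinity>\<^sup>m\<close> with inverse \<open>R\<close>, and let
  \<open>y i\<close> be the images of the unit vectors under \<open>R\<close>, divided by the norm of \<open>R\<close>. The coordinates of \<open>x\<close>
  are then bounded by \<open>norm x\<close> times the product of the two norms. The constant \<open>l + 1\<close> instead of \<open>l\<close> appears because the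
  infimum in the Banach--Mazur distance need not be attained.\<close>

lemma script_L_infty_frame:
  assumes "script_L_infty TYPE('a::real_normed_vector)"
  obtains C where "0 < C"
    "\<And>A :: 'a set. finite A \<Longrightarrow> \<exists>m y. linf_frame C A m y"
proof -
  obtain l where l: "1 \<le> l" "\<And>F :: 'a set. fin_dim_subspace F \<Longrightarrow>
      \<exists>G. fin_dim_subspace G \<and> F \<subseteq> G \<and> banach_mazur_dist G (linf_fin (dim G)) \<le> ereal l"
    using assms unfolding script_L_infty_def by blast
  have "\<exists>m y. linf_frame (l + 1) A m y"
    if A: "finite A" for A :: "'a set"
  proof -
    have "fin_dim_subspace (span A)" using A by (auto simp: fin_dim_subspace_def)
    then obtain G where G: "fin_dim_subspace G" "span A \<subseteq> G"
      and d: "banach_mazur_dist G (linf_fin (dim G)) \<le> ereal l"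
      using l(2) by blast
    define W where "W = linf_fin (dim G)"
    have sG: "subspace G" using G by (simp add: fin_dim_subspace_def)
    have "banach_mazur_dist G W < ereal (l + 1)" using d by (simp add: W_def order_le_less_trans)
    then obtain T where T: "linear T" "bij_betw T G W"
      and prod: "opnorm_on G T * opnorm_on W (inv_into G T) < ereal (l + 1)"
      unfolding banach_mazur_dist_def INF_less_iff by blast
    define R where "R = inv_into G T"
    have RG: "R w \<in> G" and TR: "T (R w) = w" if "w \<in> W" for w
      using T(2) that by (auto simp: R_def bij_betw_def inv_into_into f_inv_into_f)
    have RT: "R (T x) = x" if "x \<in> G" for x
      using T(2) that by (simp add: R_def bij_betw_def)
    have TW: "T x \<in> W" if "x \<in> G" for x
      using T(2) that by (auto simp: bij_betw_def)
    have sW: "subspace W" by (simp add: W_def subspace_linf_fin)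
    have R_scale: "R (c *\<^sub>R w) = c *\<^sub>R R w" if "w \<in> W" for c w
      using RT[of "c *\<^sub>R R w"] RG[OF that] TR[OF that] sG
      by (simp add: subspace_scale linear_scale[OF T(1)])
    have R_comb: "R (\<Sum>i<m. s i *\<^sub>R w i) = (\<Sum>i<m. s i *\<^sub>R R (w i))" if "\<And>i. i < m \<Longrightarrow> w i \<in> W" for m s and w :: "nat \<Rightarrow> _"
    proof -
      have "T (\<Sum>i<m. s i *\<^sub>R R (w i)) = (\<Sum>i<m. s i *\<^sub>R w i)"
        using that by (simp add: linear_sum[OF T(1)] linear_scale[OF T(1)] TR)
      moreover have "(\<Sum>i<m. s i *\<^sub>R R (w i)) \<in> G"
        using that sG by (auto intro!: subspace_sum subspace_scale RG)
      ultimately show ?thesis using RT by metis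
    qed
    show ?thesis
    proof (cases "G = {0}")
      case True
      then have "\<forall>x\<in>A. x = 0" using G(2) span_superset by blast
      then have "linf_frame (l + 1) A 0 y" for y by (auto simp: linf_frame_def)
      then show ?thesis by blast
    next
      case False
      then obtain g where g: "g \<in> G" "g \<noteq> 0" using subspace_0[OF sG] by blast
      have Tg: "T g \<noteq> 0" using RT[OF g(1)] RT[OF subspace_0[OF sG]] linear_0[OF T(1)] g(2) by auto
      \<comment> \<open>As \<open>0 * \<infinity> = 0\<close>, a finite product makes both norms finite only if they are positive; this is
        why \<open>G = {0}\<close> is a separate case.\<close>
      have pos: "0 < opnorm_on V S"
        if "x \<in> V" "x \<noteq> 0" "S x \<noteq> 0" "subspace V" "\<And>c x. x \<in> V \<Longrightarrow> S (c *\<^sub>R x) = c *\<^sub>R S x"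
        for V :: "'c::real_normed_vector set" and S :: "'c \<Rightarrow> 'd::real_normed_vector" and x
      proof (rule ccontr)
        assume "\<not> 0 < opnorm_on V S"
        then have "opnorm_on V S \<le> ereal 0" by (simp add: zero_ereal_def[symmetric])
        from opnorm_on_le[OF that(4,1,5) this] show False using that(3) by simp
      qed
      define a where "a = opnorm_on G T"
      define b where "b = opnorm_on W R"
      have a: "0 < a" unfolding a_def using g Tg sG by (intro pos) (auto simp: linear_scale[OF T(1)])
      have b: "0 < b" unfolding b_def
        using TW[OF g(1)] Tg g(2) RT[OF g(1)] sW R_scale by (intro pos[of "T g"]) auto
      have ab: "a * b < ereal (l + 1)" using prod by (simp add: a_def b_def R_def)
      then obtain a' b' where ab': "a = ereal a'" "b = ereal b'"
        using a b by (cases a; cases b) (auto split: if_splits)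
      have pos': "0 < a'" "0 < b'" "a' * b' < l + 1" using a b ab ab' by auto
      have Tle: "norm (T x) \<le> a' * norm x" if "x \<in> G" for x
        using that ab' sG by (intro opnorm_on_le[of G]) (auto simp: linear_scale[OF T(1)] a_def)
      have Rle: "norm (R w) \<le> b' * norm w" if "w \<in> W" for w
        using that ab' sW R_scale by (intro opnorm_on_le[of W]) (auto simp: b_def)
      define m where "m = dim G"
      define y where "y i = (1 / b') *\<^sub>R R (unit_seq i)" for i
      have uW: "unit_seq i \<in> W" if "i < m" for i
        using that by (auto simp: W_def m_def linf_fin_def apply_unit_seq)
      have comb: "(\<Sum>i<m. s i *\<^sub>R y i) = (1 / b') *\<^sub>R R (\<Sum>i<m. s i *\<^sub>R unit_seq i)" for s
        using uW by (simp add: R_comb y_def scaleR_sum_right mult.commute)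
      have "norm (\<Sum>i<m. s i *\<^sub>R y i) \<le> 1" if "\<forall>i<m. \<bar>s i\<bar> \<le> 1" for s
      proof -
        have "norm (R (\<Sum>i<m. s i *\<^sub>R unit_seq i)) \<le> b' * norm (\<Sum>i<m. s i *\<^sub>R unit_seq i)"
          by (rule Rle) (simp add: W_def m_def comb_in_linf_fin)
        also have "\<dots> \<le> b' * 1"
          using that pos' by (intro mult_left_mono norm_comb_le) auto
        finally show ?thesis using pos' by (simp add: comb)
      qed
      moreover have "\<exists>u. x = (\<Sum>i<m. u i *\<^sub>R y i) \<and> (\<forall>i<m. \<bar>u i\<bar> \<le> (l + 1) * norm x)" if "x \<in> A" for x
      proof (intro exI conjI allI impI)
        have x: "x \<in> G" using that G(2) span_superset by blast
        let ?u = "\<lambda>i. b' * apply_bcontfun (T x) i"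
        have "(\<Sum>i<m. apply_bcontfun (T x) i *\<^sub>R unit_seq i) = T x"
          using linf_fin_expand[of "T x" m] TW[OF x] by (simp add: W_def m_def)
        moreover have "(\<Sum>i<m. ?u i *\<^sub>R y i) = b' *\<^sub>R (\<Sum>i<m. apply_bcontfun (T x) i *\<^sub>R y i)"
          by (simp add: scaleR_sum_right)
        ultimately show "x = (\<Sum>i<m. ?u i *\<^sub>R y i)"
          using pos' RT[OF x] by (simp add: comb)
        fix i
        have "\<bar>apply_bcontfun (T x) i\<bar> \<le> norm (T x)"
          using norm_bounded[of "T x" i] by simp
        also have "\<dots> \<le> a' * norm x" by (rule Tle[OF x])
        finally have "\<bar>?u i\<bar> \<le> (a' * b') * norm x"
          using pos' by (simp add: abs_mult mult.commute mult.left_commute)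
        also have "\<dots> \<le> (l + 1) * norm x" using pos' by (intro mult_right_mono) auto
        finally show "\<bar>?u i\<bar> \<le> (l + 1) * norm x" .
      qed
      ultimately have "linf_frame (l + 1) A m y" unfolding linf_frame_def by blast
      then show ?thesis by blast
    qed
  qed
  with l(1) show thesis by (intro that[of "l + 1"]) auto
qed

lemma compact_insert_0_Union:
  fixes S :: "nat \<Rightarrow> 'a::real_normed_vector set"
  assumes fin: "\<And>n. finite (S n)" and le: "\<And>n x. x \<in> S n \<Longrightarrow> norm x \<le> c n" and c: "c \<longlonglongrightarrow> 0"
  shows "compact (insert 0 (\<Union>n. S n))"
proof (rule compactI)
  fix \<U> assume o: "\<forall>U\<in>\<U>. open U" and cov: "insert 0 (\<Union>n. S n) \<subseteq> \<Union>\<U>"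
  obtain U where U: "U \<in> \<U>" "0 \<in> U" using cov by blast
  then obtain e where e: "0 < e" "ball 0 e \<subseteq> U" using o openE by metis
  obtain N where N: "\<And>n. n \<ge> N \<Longrightarrow> c n < e"
    using order_tendstoD(2)[OF c e(1)] by (auto simp: eventually_sequentially)
  have fin': "finite (\<Union>n<N. S n)" using fin by blast
  have "\<forall>x\<in>(\<Union>n<N. S n). \<exists>V\<in>\<U>. x \<in> V" using cov by blast
  then obtain V where V: "\<And>x. x \<in> (\<Union>n<N. S n) \<Longrightarrow> V x \<in> \<U> \<and> x \<in> V x" by metis
  have "insert 0 (\<Union>n. S n) \<subseteq> \<Union> (insert U (V ` (\<Union>n<N. S n)))"
  proof
    fix x assume "x \<in> insert 0 (\<Union>n. S n)"
    then consider "x = 0" | n where "x \<in> S n" "n < N" | n where "x \<in> S n" "n \<ge> N"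
      by (metis UN_E insertE not_less)
    then show "x \<in> \<Union> (insert U (V ` (\<Union>n<N. S n)))"
    proof cases
      case 1 then show ?thesis using U by auto
    next
      case (2 n) then show ?thesis using V by blast
    next
      case (3 n)
      then have "norm x < e" using le N by (meson le_less_trans)
      then show ?thesis using e by auto
    qed
  qed
  moreover have "finite (insert U (V ` (\<Union>n<N. S n)))" "insert U (V ` (\<Union>n<N. S n)) \<subseteq> \<U>"
    using fin' U V by auto
  ultimately show "\<exists>\<C>\<subseteq>\<U>. finite \<C> \<and> insert 0 (\<Union>n. S n) \<subseteq> \<Union>\<C>" by blast
qed

text \<open>A double family is turned into a sequence, so that its sums become norms in the one fixed space \<open>\<ell>\<^sub>1\<close>.\<close>

lemma double_sum_by_prod_decode:
  fixes g :: "nat \<Rightarrow> nat \<Rightarrow> real"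
  assumes pos: "\<And>n i. 0 \<le> g n i" and zero: "\<And>n i. m n \<le> i \<Longrightarrow> g n i = 0"
    and le: "\<And>n. (\<Sum>i<m n. g n i) \<le> c n" and c: "summable c"
  defines "h \<equiv> \<lambda>j. case prod_decode j of (n, i) \<Rightarrow> g n i"
  shows "summable h" "suminf h \<le> suminf c" "(\<Sum>n<N. \<Sum>i<m n. g n i) \<le> suminf h"
proof -
  have h_pos: "0 \<le> h j" for j by (simp add: h_def pos split_beta)
  have c_pos: "0 \<le> c n" for n using order_trans[OF sum_nonneg le[of n]] pos by blast
  have box: "(\<Sum>j\<in>prod_encode ` Sigma {..<N} (\<lambda>n. {..<m n}). h j) = (\<Sum>n<N. \<Sum>i<m n. g n i)" for N
    by (subst sum.reindex) (auto simp: inj_on_def h_def sum.Sigma)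
  have part: "(\<Sum>j<J. h j) \<le> suminf c" for J
  proof -
    let ?B = "prod_encode ` Sigma {..<J} (\<lambda>n. {..<m n})"
    have "h j = 0" if "j < J" "j \<notin> ?B" for j
    proof -
      obtain n i where ni: "prod_decode j = (n, i)" by fastforce
      then have j: "j = prod_encode (n, i)" by (metis prod_decode_inverse)
      then have "n < J" using le_prod_encode_1[of n i] that(1) by simp
      with j that(2) have "m n \<le> i" by (force simp: not_less[symmetric])
      then show ?thesis by (simp add: h_def ni zero)
    qed
    then have "(\<Sum>j<J. h j) = (\<Sum>j\<in>{..<J} \<inter> ?B. h j)"
      by (intro sum.mono_neutral_right) auto
    also have "\<dots> \<le> (\<Sum>j\<in>?B. h j)"
      using h_pos by (intro sum_mono2) auto
    also have "\<dots> \<le> (\<Sum>n<J. c n)" unfolding box by (intro sum_mono le)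
    also have "\<dots> \<le> suminf c" using c c_pos by (intro sum_le_suminf) auto
    finally show ?thesis .
  qed
  show sm: "summable h"
    by (rule summableI_nonneg_bounded[OF h_pos part])
  show "suminf h \<le> suminf c"
    by (rule suminf_le_const[OF sm part])
  show "(\<Sum>n<N. \<Sum>i<m n. g n i) \<le> suminf h"
    unfolding box[symmetric] using sm h_pos by (intro sum_le_suminf) auto
qed

text \<open>The \<open>\<ell>\<^sub>1\<close>-norm of the values of \<open>f\<close> is the value of \<open>f\<close> at one of finitely many signed sums, so it
  is controlled by a bound for \<open>f\<close> on a finite set.\<close>

lemma sum_abs_eq_signed:
  fixes f :: "'a::real_normed_vector \<Rightarrow>\<^sub>L real"
  obtains s where "s \<in> {..<m} \<rightarrow>\<^sub>E {- 1, 1}" "(\<Sum>i<m. \<bar>f (y i)\<bar>) = f (\<Sum>i<m. s i *\<^sub>R y i)"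
proof
  let ?s = "\<lambda>i\<in>{..<m}. if 0 \<le> f (y i) then 1 else - 1 :: real"
  show "?s \<in> {..<m} \<rightarrow>\<^sub>E {- 1, 1}" by auto
  show "(\<Sum>i<m. \<bar>f (y i)\<bar>) = f (\<Sum>i<m. ?s i *\<^sub>R y i)"
    by (auto simp: blinfun.sum_right blinfun.scaleR_right intro!: sum.cong)
qed

lemma compact_bounded_blinfun:
  fixes f :: "'a::real_normed_vector \<Rightarrow>\<^sub>L real"
  assumes "compact L" obtains M where "\<And>x. x \<in> L \<Longrightarrow> \<bar>blinfun_apply f x\<bar> \<le> M"
proof -
  have "compact (blinfun_apply f ` L)"
    by (rule compact_continuous_image[OF _ assms]) (intro continuous_intros)
  then obtain M where "\<forall>r\<in>blinfun_apply f ` L. norm r \<le> M"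
    using compact_imp_bounded bounded_iff by metis
  then show thesis by (intro that[of M]) auto
qed

definition l1_seminorm :: "(nat \<Rightarrow> 'a) \<Rightarrow> ('a::real_normed_vector \<Rightarrow>\<^sub>L real) \<Rightarrow> real" where
  "l1_seminorm z f = (\<Sum>n. \<bar>blinfun_apply f (z n)\<bar>)"

text \<open>The second condition says that \<open>f \<mapsto> (f (z n))\<^sub>n\<close> is continuous from \<^const>\<open>tau_k\<close> to \<open>\<ell>\<^sub>1\<close>: it maps
  the functionals that are small on the compact set \<open>L\<close> to sequences of small norm.\<close>

definition summing :: "(nat \<Rightarrow> 'a::real_normed_vector) \<Rightarrow> bool" where
  "summing z \<longleftrightarrow> (\<forall>f :: 'a \<Rightarrow>\<^sub>L real. summable (\<lambda>n. \<bar>blinfun_apply f (z n)\<bar>)) \<and>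
    (\<exists>L. compact L \<and> (\<forall>(f :: 'a \<Rightarrow>\<^sub>L real) M. (\<forall>x\<in>L. \<bar>blinfun_apply f x\<bar> \<le> M) \<longrightarrow> l1_seminorm z f \<le> M))"

text \<open>Approximating a point of \<open>K\<close> by finite nets of radii \<open>\<rho> n\<close>, a multiple of \<open>4\<^bsup>-n\<^esup>\<close>, writes it as a series
  of differences \<open>d n\<close>, each from a finite set \<open>D n\<close> and of norm \<open>O(4\<^bsup>-n\<^esup>)\<close>. A frame \<open>y n\<close> for \<open>D n\<close>
  expresses \<open>d n\<close> with coefficients \<open>O(4\<^bsup>-n\<^esup>)\<close>, so the vectors \<open>4\<^bsup>-n\<^esup> y n i\<close>, up to a constant, form a
  sequence \<open>z\<close> with \<open>\<bar>f x\<bar> \<le> \<Sum>n. \<bar>f (z n)\<bar>\<close>. On the other hand the frame vectors have signed sums of norm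
  at most 1. Hence the signed sums multiplied by only \<open>2\<^bsup>-n\<^esup>\<close> still tend to 0 and form a compact set \<open>L\<close>;
  a bound for \<open>f\<close> on \<open>L\<close> leaves a factor \<open>2\<^bsup>-n\<^esup>\<close> in the \<open>n\<close>-th block, and the blocks can be summed.\<close>
lemma compact_dominated_by_summing_sequence:
  fixes K :: "'a::real_normed_vector set"
  assumes L: "script_L_infty TYPE('a)" and K: "compact K"
  shows "\<exists>z. summing z \<and> (\<forall>f. \<forall>x\<in>K. \<bar>blinfun_apply f x\<bar> \<le> l1_seminorm z f)"
proof -
  obtain C where C: "0 < C"
    "\<And>A :: 'a set. finite A \<Longrightarrow> \<exists>m y. linf_frame C A m y"
    using script_L_infty_frame[OF L] by blast
  obtain R where R: "0 < R" "\<And>x. x \<in> K \<Longrightarrow> norm x \<le> R"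
    using compact_imp_bounded[OF K] unfolding bounded_pos by blast
  define \<rho> where "\<rho> n = R * (1 / 4) ^ Suc n" for n
  have \<rho>: "0 < \<rho> n" for n using R by (simp add: \<rho>_def)
  have "\<exists>A. finite A \<and> K \<subseteq> (\<Union>a\<in>A. ball a (\<rho> n))" for n
    using K \<rho>[of n] unfolding compact_eq_totally_bounded by blast
  then obtain A where A: "\<And>n. finite (A n)" "\<And>n. K \<subseteq> (\<Union>a\<in>A n. ball a (\<rho> n))" by metis
  define D where "D n = (case n of 0 \<Rightarrow> A 0 | Suc k \<Rightarrow> (\<lambda>(a, b). a - b) ` (A (Suc k) \<times> A k))" for n
  have "finite (D n)" for n using A by (cases n) (auto simp: D_def)
  then have "\<forall>n. \<exists>m y. linf_frame C (D n) m y" using C(2) by blast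
  then obtain m y where my: "\<And>n. linf_frame C (D n) (m n) (y n)" by metis
  have y1: "norm (\<Sum>i<m n. s i *\<^sub>R y n i) \<le> 1" if "\<And>i. i < m n \<Longrightarrow> \<bar>s i\<bar> \<le> 1" for n s
    using my[of n] that unfolding linf_frame_def by blast
  have y2: "\<exists>u. x = (\<Sum>i<m n. u i *\<^sub>R y n i) \<and> (\<forall>i<m n. \<bar>u i\<bar> \<le> C * norm x)" if "x \<in> D n" for n x
    using my[of n] that unfolding linf_frame_def by blast
  define B where "B = 2 * R * C"
  have B: "0 < B" using R C by (simp add: B_def)
  \<comment> \<open>The weight \<open>4\<^bsup>-n\<^esup>\<close> of \<open>w\<close> is the product of the weight \<open>2\<^bsup>-n\<^esup>\<close> that makes \<open>L\<close> compact and a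
    spare \<open>2\<^bsup>-n\<^esup>\<close> that makes the blocks summable; \<open>w n i\<close> is 0 beyond the frame so that it can be
    indexed by all pairs.\<close>
  define w where "w n i = (if i < m n then (B * (1 / 4) ^ n) *\<^sub>R y n i else 0)" for n i
  define P where "P n = (\<lambda>s. \<Sum>i<m n. s i *\<^sub>R y n i) ` ({..<m n} \<rightarrow>\<^sub>E {- 1, 1})" for n
  define L where "L = insert 0 (\<Union>n. (*\<^sub>R) (2 * B * (1 / 2) ^ n) ` P n)"
  have "compact L"
    unfolding L_def
  proof (rule compact_insert_0_Union)
    show "finite ((*\<^sub>R) (2 * B * (1 / 2) ^ n) ` P n)" for n
      by (auto simp: P_def intro: finite_PiE)
    show "norm x \<le> 2 * B * (1 / 2) ^ n" if x: "x \<in> (*\<^sub>R) (2 * B * (1 / 2) ^ n) ` P n" for n x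
    proof -
      obtain s where s: "s \<in> {..<m n} \<rightarrow>\<^sub>E {- 1, 1}" "x = (2 * B * (1 / 2) ^ n) *\<^sub>R (\<Sum>i<m n. s i *\<^sub>R y n i)"
        using x by (auto simp: P_def)
      have "\<bar>s i\<bar> \<le> 1" if "i < m n" for i
        using PiE_mem[OF s(1), of i] that by auto
      then have "norm (\<Sum>i<m n. s i *\<^sub>R y n i) \<le> 1" by (rule y1)
      then show ?thesis using B mult_left_mono[of _ 1 "2 * B * (1 / 2) ^ n"] by (simp add: s(2))
    qed
    show "(\<lambda>n. 2 * B * (1 / 2) ^ n) \<longlonglongrightarrow> 0"
      by (intro tendsto_mult_right_zero LIMSEQ_power_zero) simp
  qed
  have w_le: "(\<Sum>i<m n. \<bar>f (w n i)\<bar>) \<le> M * (1 / 2) ^ Suc n"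
    if M: "\<And>x. x \<in> L \<Longrightarrow> \<bar>f x\<bar> \<le> M" for f :: "'a \<Rightarrow>\<^sub>L real" and M n
  proof -
    obtain s where s: "s \<in> {..<m n} \<rightarrow>\<^sub>E {- 1, 1}" "(\<Sum>i<m n. \<bar>f (y n i)\<bar>) = f (\<Sum>i<m n. s i *\<^sub>R y n i)"
      by (rule sum_abs_eq_signed)
    have "(2 * B * (1 / 2) ^ n) *\<^sub>R (\<Sum>i<m n. s i *\<^sub>R y n i) \<in> L"
      using s(1) by (auto simp: L_def P_def)
    from M[OF this] have "2 * B * (1 / 2) ^ n * (\<Sum>i<m n. \<bar>f (y n i)\<bar>) \<le> M"
      by (simp add: blinfun.scaleR_right s(2))
    then have "(2 * B * (1 / 2) ^ n * (\<Sum>i<m n. \<bar>f (y n i)\<bar>)) * (1 / 2) ^ Suc n \<le> M * (1 / 2) ^ Suc n"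
      by (rule mult_right_mono) simp
    moreover have "(\<Sum>i<m n. \<bar>f (w n i)\<bar>) = B * (1 / 4) ^ n * (\<Sum>i<m n. \<bar>f (y n i)\<bar>)"
      using B by (simp add: w_def blinfun.scaleR_right abs_mult sum_distrib_left)
    moreover have "(1 / 4 :: real) ^ n = (1 / 2) ^ n * (1 / 2) ^ n"
      by (simp add: power_mult_distrib[symmetric])
    ultimately show ?thesis by (simp add: mult_ac)
  qed
  define z where "z j = (case prod_decode j of (n, i) \<Rightarrow> w n i)" for j
  have z: "(\<lambda>j. \<bar>f (z j)\<bar>) = (\<lambda>j. case prod_decode j of (n, i) \<Rightarrow> \<bar>f (w n i)\<bar>)" for f :: "'a \<Rightarrow>\<^sub>L real"
    by (simp add: z_def fun_eq_iff split_beta)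
  have facts: "summable (\<lambda>n. \<bar>f (z n)\<bar>) \<and> (\<Sum>n. \<bar>f (z n)\<bar>) \<le> M \<and>
      (\<Sum>n<N. \<Sum>i<m n. \<bar>f (w n i)\<bar>) \<le> (\<Sum>n. \<bar>f (z n)\<bar>)"
    if M: "\<And>x. x \<in> L \<Longrightarrow> \<bar>f x\<bar> \<le> M" for f :: "'a \<Rightarrow>\<^sub>L real" and M N
  proof -
    have c: "(\<lambda>n. M * (1 / 2) ^ Suc n) sums M"
      using sums_mult[OF power_half_series, of M] by simp
    show ?thesis
      using double_sum_by_prod_decode[where g = "\<lambda>n i. \<bar>f (w n i)\<bar>" and m = m, OF _ _ w_le[OF M] sums_summable[OF c]]
      unfolding z sums_unique[OF c, symmetric] by (simp add: w_def)
  qed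
  have bounded: "\<exists>M. \<forall>x\<in>L. \<bar>blinfun_apply f x\<bar> \<le> M" for f :: "'a \<Rightarrow>\<^sub>L real"
    using compact_bounded_blinfun[OF \<open>compact L\<close>] by metis
  have K_le: "\<bar>f x\<bar> \<le> (\<Sum>n. \<bar>f (z n)\<bar>)" if x: "x \<in> K" for f :: "'a \<Rightarrow>\<^sub>L real" and x
  proof -
    have "\<exists>a\<in>A n. dist a x < \<rho> n" for n using subsetD[OF A(2)[of n] x] by auto
    then obtain a where a: "\<And>n. a n \<in> A n" "\<And>n. dist (a n) x < \<rho> n" by metis
    define d where "d n = (case n of 0 \<Rightarrow> a 0 | Suc k \<Rightarrow> a (Suc k) - a k)" for n
    have dD: "d n \<in> D n" for n using a(1) by (cases n) (auto simp: d_def D_def)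
    have norm_d: "norm (d n) \<le> 2 * R * (1 / 4) ^ n" for n
    proof (cases n)
      case 0
      have "norm (a 0) \<le> norm x + dist (a 0) x" by (simp add: dist_norm norm_triangle_sub)
      then show ?thesis using 0 a(2)[of 0] R(1) R(2)[OF x] by (simp add: d_def \<rho>_def)
    next
      case (Suc k)
      have "norm (a (Suc k) - a k) \<le> dist (a (Suc k)) x + dist (a k) x"
        by (metis dist_norm dist_triangle2)
      also have "\<dots> \<le> \<rho> (Suc k) + \<rho> k" using a(2) by (intro add_mono less_imp_le)
      also have "\<dots> \<le> 2 * R * (1 / 4) ^ n" using R by (simp add: Suc \<rho>_def)
      finally show ?thesis by (simp add: d_def Suc)
    qed
    have f_d: "\<bar>f (d n)\<bar> \<le> (\<Sum>i<m n. \<bar>f (w n i)\<bar>)" for n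
    proof -
      obtain u where u: "d n = (\<Sum>i<m n. u i *\<^sub>R y n i)" "\<And>i. i < m n \<Longrightarrow> \<bar>u i\<bar> \<le> C * norm (d n)"
        using y2[OF dD] by blast
      have u': "\<bar>u i\<bar> \<le> B * (1 / 4) ^ n" if "i < m n" for i
        using order_trans[OF u(2)[OF that] mult_left_mono[OF norm_d[of n] less_imp_le[OF C(1)]]]
        by (simp add: B_def mult_ac)
      have "\<bar>f (d n)\<bar> \<le> (\<Sum>i<m n. \<bar>u i * f (y n i)\<bar>)"
        unfolding u(1) by (simp add: blinfun.sum_right blinfun.scaleR_right sum_abs)
      also have "\<dots> \<le> (\<Sum>i<m n. \<bar>f (w n i)\<bar>)"
        using u' B by (intro sum_mono) (auto simp: w_def blinfun.scaleR_right abs_mult intro!: mult_right_mono)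
      finally show ?thesis .
    qed
    have tele: "(\<Sum>n<Suc N. d n) = a N" for N
      by (induction N) (simp_all add: d_def)
    have bound: "\<bar>f (a N)\<bar> \<le> (\<Sum>n. \<bar>f (z n)\<bar>)" for N
    proof -
      have "\<bar>f (a N)\<bar> \<le> (\<Sum>n<Suc N. \<bar>f (d n)\<bar>)"
        unfolding tele[symmetric] blinfun.sum_right by (rule sum_abs)
      also have "\<dots> \<le> (\<Sum>n<Suc N. \<Sum>i<m n. \<bar>f (w n i)\<bar>)" by (intro sum_mono f_d)
      also have "\<dots> \<le> (\<Sum>n. \<bar>f (z n)\<bar>)" using bounded[of f] facts by blast
      finally show ?thesis .
    qed
    have "\<rho> \<longlonglongrightarrow> 0"
      unfolding \<rho>_def by (intro tendsto_mult_right_zero LIMSEQ_Suc LIMSEQ_power_zero) simp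
    then have "(\<lambda>n. dist (a n) x) \<longlonglongrightarrow> 0"
      by (rule Lim_null_comparison[rotated]) (use a(2) in \<open>auto intro!: always_eventually less_imp_le\<close>)
    then have "a \<longlonglongrightarrow> x" by (rule tendsto_dist_iff[THEN iffD2])
    then have "(\<lambda>n. \<bar>f (a n)\<bar>) \<longlonglongrightarrow> \<bar>f x\<bar>"
      by (intro tendsto_intros)
    then show ?thesis by (rule LIMSEQ_le_const2) (use bound in blast)
  qed
  have summable: "summable (\<lambda>n. \<bar>f (z n)\<bar>)" for f :: "'a \<Rightarrow>\<^sub>L real"
    using bounded[of f] facts by blast
  have le: "(\<Sum>n. \<bar>f (z n)\<bar>) \<le> M" if "\<And>x. x \<in> L \<Longrightarrow> \<bar>f x\<bar> \<le> M" for f :: "'a \<Rightarrow>\<^sub>L real" and M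
    using facts[OF that] by blast
  have "summing z"
    unfolding summing_def l1_seminorm_def using \<open>compact L\<close> summable le by metis
  then show ?thesis
    unfolding l1_seminorm_def using K_le by (intro exI[of _ z]) simp
qed

section \<open>Embeddings for the topology of uniform convergence on compact sets\<close>

lemma tau_k_continuousI:
  fixes h :: "('a::real_normed_vector \<Rightarrow>\<^sub>L real) \<Rightarrow> 'm::metric_space"
  assumes L: "compact L"
    and le: "\<And>(f :: 'a \<Rightarrow>\<^sub>L real) (g :: 'a \<Rightarrow>\<^sub>L real) M. (\<And>x. x \<in> L \<Longrightarrow> \<bar>blinfun_apply f x - blinfun_apply g x\<bar> \<le> M) \<Longrightarrow> dist (h f) (h g) \<le> M"
  shows "continuous_map tau_k euclidean h"
proof -
  have "openin tau_k (h -` U)" if "open U" for U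
    unfolding openin_tau_k
  proof
    fix f assume "f \<in> h -` U"
    then obtain e where e: "0 < e" "ball (h f) e \<subseteq> U" using \<open>open U\<close> openE by blast
    have "g \<in> h -` U" if "\<forall>x\<in>L. \<bar>blinfun_apply g x - blinfun_apply f x\<bar> < e / 2" for g :: "'a \<Rightarrow>\<^sub>L real"
    proof -
      have "dist (h f) (h g) \<le> e / 2"
        using that by (intro le) (auto simp: abs_minus_commute less_imp_le)
      also have "\<dots> < e" using e by simp
      finally show ?thesis using e(2) by auto
    qed
    then show "\<exists>K e. compact K \<and> 0 < e \<and> {g. \<forall>x\<in>K. \<bar>blinfun_apply g x - blinfun_apply f x\<bar> < e} \<subseteq> h -` U"
      using L e(1) by (intro exI[of _ L] exI[of _ "e / 2"]) auto
  qed
  then show ?thesis by (auto simp: continuous_map_def vimage_def)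
qed

text \<open>For the inverse to be continuous it suffices to recover the condition \<open>\<bar>g x - f x\<bar> \<le> 1\<close> on each compact
  set, since multiples of compact sets are compact and the functionals are homogeneous. Injectivity is the case
  of one-point sets. The target may be a monoid, since the inverse of the image of \<open>f\<close> is the image of \<open>- f\<close>.\<close>

lemma tau_k_embeddingI:
  fixes \<phi> :: "('a::real_normed_vector \<Rightarrow>\<^sub>L real) \<Rightarrow> 'h"
  assumes H: "monoid H"
    and closed: "\<And>f. \<phi> f \<in> carrier H"
    and add: "\<And>f g. \<phi> (f + g) = \<phi> f \<otimes>\<^bsub>H\<^esub> \<phi> g"
    and zero: "\<phi> 0 = \<one>\<^bsub>H\<^esub>"
    and cont: "continuous_map tau_k TH \<phi>"
    and nbhd: "\<And>K (f :: 'a \<Rightarrow>\<^sub>L real). compact K \<Longrightarrow>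
      \<exists>V. openin TH V \<and> \<phi> f \<in> V \<and> (\<forall>g :: 'a \<Rightarrow>\<^sub>L real. \<phi> g \<in> V \<longrightarrow> (\<forall>x\<in>K. \<bar>blinfun_apply g x - blinfun_apply f x\<bar> \<le> 1))"
  shows "isomorphic_to_subgroup_of (additive_group :: ('a \<Rightarrow>\<^sub>L real) monoid) tau_k H TH"
proof -
  interpret monoid H by fact
  let ?S = "range \<phi>"
  have nbhd': "\<exists>V. openin TH V \<and> \<phi> f \<in> V \<and> (\<forall>g :: 'a \<Rightarrow>\<^sub>L real. \<phi> g \<in> V \<longrightarrow> (\<forall>x\<in>K. \<bar>blinfun_apply g x - blinfun_apply f x\<bar> < e))"
    if K: "compact K" and e: "0 < e" for K and f :: "'a \<Rightarrow>\<^sub>L real" and e :: real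
  proof -
    have "compact ((*\<^sub>R) (2 / e) ` K)"
      using K by (rule compact_scaling)
    then obtain V where V: "openin TH V" "\<phi> f \<in> V"
      "\<And>(g :: 'a \<Rightarrow>\<^sub>L real) x. \<phi> g \<in> V \<Longrightarrow> x \<in> K \<Longrightarrow> \<bar>blinfun_apply g ((2 / e) *\<^sub>R x) - blinfun_apply f ((2 / e) *\<^sub>R x)\<bar> \<le> 1"
      using nbhd[of "(*\<^sub>R) (2 / e) ` K" f] by blast
    have "\<bar>blinfun_apply g x - blinfun_apply f x\<bar> < e" if "\<phi> g \<in> V" "x \<in> K" for g :: "'a \<Rightarrow>\<^sub>L real" and x
    proof -
      have "2 / e * \<bar>blinfun_apply g x - blinfun_apply f x\<bar> \<le> 1"
        using V(3)[OF that] e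
        by (simp add: blinfun.scaleR_right right_diff_distrib[symmetric] abs_mult flip: times_divide_eq_left)
      then show ?thesis using e by (simp add: field_simps)
    qed
    with V show ?thesis by blast
  qed
  have inj: "inj \<phi>"
  proof (rule injI)
    fix f g assume eq: "\<phi> f = \<phi> g"
    have "g x = f x" for x
    proof (rule ccontr)
      assume "g x \<noteq> f x"
      then show False using nbhd'[of "{x}" "\<bar>blinfun_apply g x - blinfun_apply f x\<bar>" f] eq by auto
    qed
    then show "f = g" by (intro blinfun_eqI) simp
  qed
  have "subgroup ?S H"
  proof
    show "?S \<subseteq> carrier H" using closed by auto
    show "x \<otimes>\<^bsub>H\<^esub> y \<in> ?S" if "x \<in> ?S" "y \<in> ?S" for x y
      using that by (auto simp: add[symmetric])
    show "\<one>\<^bsub>H\<^esub> \<in> ?S" unfolding zero[symmetric] by (rule rangeI)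
    show "inv\<^bsub>H\<^esub> x \<in> ?S" if "x \<in> ?S" for x
    proof -
      obtain f where f: "x = \<phi> f" using \<open>x \<in> ?S\<close> by blast
      have "\<phi> f \<otimes>\<^bsub>H\<^esub> \<phi> (- f) = \<one>\<^bsub>H\<^esub>" "\<phi> (- f) \<otimes>\<^bsub>H\<^esub> \<phi> f = \<one>\<^bsub>H\<^esub>"
        by (simp_all add: add[symmetric] zero)
      then have "inv\<^bsub>H\<^esub> x = \<phi> (- f)" unfolding f by (intro inv_char closed)
      then show ?thesis by simp
    qed
  qed
  moreover have iso: "\<phi> \<in> iso additive_group (H\<lparr>carrier := ?S\<rparr>)"
    using inj add by (auto simp: iso_def hom_def additive_group_def bij_betw_def)
  moreover have "homeomorphic_map tau_k (subtopology TH ?S) \<phi>"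
  proof (rule bijective_open_imp_homeomorphic_map)
    have sub: "?S \<subseteq> topspace TH" using continuous_map_image_subset_topspace[OF cont] by simp
    show "continuous_map tau_k (subtopology TH ?S) \<phi>"
      using cont by (simp add: continuous_map_in_subtopology)
    show "\<phi> ` topspace tau_k = topspace (subtopology TH ?S)" using sub by auto
    show "inj_on \<phi> (topspace tau_k)" using inj by simp
    show "open_map tau_k (subtopology TH ?S) \<phi>"
      unfolding open_map_def
    proof (intro allI impI)
      fix U :: "('a \<Rightarrow>\<^sub>L real) set" assume U: "openin tau_k U"
      have "\<exists>T. openin (subtopology TH ?S) T \<and> \<phi> f \<in> T \<and> T \<subseteq> \<phi> ` U" if f: "f \<in> U" for f
      proof -
        obtain K e where Ke: "compact K" "0 < e" "{g :: 'a \<Rightarrow>\<^sub>L real. \<forall>x\<in>K. \<bar>blinfun_apply g x - blinfun_apply f x\<bar> < e} \<subseteq> U"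
          using U f unfolding openin_tau_k by blast
        obtain V where V: "openin TH V" "\<phi> f \<in> V" "\<And>g :: 'a \<Rightarrow>\<^sub>L real. \<phi> g \<in> V \<Longrightarrow> \<forall>x\<in>K. \<bar>blinfun_apply g x - blinfun_apply f x\<bar> < e"
          using nbhd'[OF Ke(1,2)] by blast
        have "?S \<inter> V \<subseteq> \<phi> ` U" using V(3) Ke(3) by blast
        then show ?thesis
          using V by (intro exI[of _ "?S \<inter> V"]) (auto simp: openin_subtopology_Int2)
      qed
      then show "openin (subtopology TH ?S) (\<phi> ` U)"
        by (subst openin_subopen) blast
    qed
  qed
  then have "topologically_isomorphic (additive_group :: ('a \<Rightarrow>\<^sub>L real) monoid) tau_k (H\<lparr>carrier := ?S\<rparr>) (subtopology TH ?S)"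
    unfolding topologically_isomorphic_def using iso by (rule bexI)
  ultimately show ?thesis
    unfolding isomorphic_to_subgroup_of_def by blast
qed

section \<open>The embedding into a power of \<open>\<ell>\<^sub>1\<close>\<close>

lemma summing_zero: "summing (\<lambda>_. 0)"
  unfolding summing_def l1_seminorm_def by (auto intro!: exI[of _ "{0}"])

lemma summingD:
  fixes f :: "'a::real_normed_vector \<Rightarrow>\<^sub>L real"
  shows "summing z \<Longrightarrow> summable (\<lambda>n. \<bar>f (z n)\<bar>)"
  by (simp add: summing_def)

lemma continuous_summing:
  fixes h :: "('a::real_normed_vector \<Rightarrow>\<^sub>L real) \<Rightarrow> 'm::metric_space"
  assumes z: "summing z" and le: "\<And>f g. dist (h f) (h g) \<le> l1_seminorm z (f - g)"
  shows "continuous_map tau_k euclidean h"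
proof -
  obtain L where L: "compact L"
    and bound: "\<forall>(f :: 'a \<Rightarrow>\<^sub>L real) M. (\<forall>x\<in>L. \<bar>blinfun_apply f x\<bar> \<le> M) \<longrightarrow> l1_seminorm z f \<le> M"
    using z unfolding summing_def by (elim conjE exE)
  show ?thesis
  proof (rule tau_k_continuousI[OF L])
    fix f g :: "'a \<Rightarrow>\<^sub>L real" and M
    assume "\<And>x. x \<in> L \<Longrightarrow> \<bar>blinfun_apply f x - blinfun_apply g x\<bar> \<le> M"
    then have "l1_seminorm z (f - g) \<le> M"
      using bound[THEN spec, of "f - g", THEN spec, of M] by (simp add: blinfun.diff_left)
    with le[of f g] show "dist (h f) (h g) \<le> M" by (rule order_trans)
  qed
qed

lemma l1_seminorm_triangle:
  assumes z: "summing z" shows "l1_seminorm z (f + g) \<le> l1_seminorm z f + l1_seminorm z g"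
  unfolding l1_seminorm_def suminf_add[OF summingD[OF z] summingD[OF z]]
  by (intro suminf_le summable_add summingD z) (simp add: blinfun.add_left)

lemma l1_seminorm_minus: "l1_seminorm z (- f) = l1_seminorm z f"
  by (simp add: l1_seminorm_def blinfun.minus_left)

lemma continuous_l1_seminorm:
  assumes z: "summing z" shows "continuous_map tau_k euclidean (\<lambda>f. l1_seminorm z (f + c))"
proof (rule continuous_summing[OF z])
  fix f g
  have "l1_seminorm z (f + c) \<le> l1_seminorm z (f - g) + l1_seminorm z (g + c)"
    using l1_seminorm_triangle[OF z, of "f - g" "g + c"] by simp
  moreover have "l1_seminorm z (g + c) \<le> l1_seminorm z (f - g) + l1_seminorm z (f + c)"
    using l1_seminorm_triangle[OF z, of "- (f - g)" "f + c"] l1_seminorm_minus[of z "f - g"] by simp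
  ultimately show "dist (l1_seminorm z (f + c)) (l1_seminorm z (g + c)) \<le> l1_seminorm z (f - g)"
    by (simp add: dist_real_def)
qed

text \<open>For summing \<open>z\<close>, the adjoint of the operator \<open>c\<^sub>0 \<rightarrow> E\<close> that sends the unit vectors to the sequence \<open>z\<close>.\<close>

definition eval_ell1 :: "(nat \<Rightarrow> 'a::real_normed_vector) \<Rightarrow> ('a \<Rightarrow>\<^sub>L real) \<Rightarrow> ell1" where
  "eval_ell1 z f = Abs_ell1 (\<lambda>n. blinfun_apply f (z n))"

lemma ell1_nth_eval: "summing z \<Longrightarrow> ell1_nth (eval_ell1 z f) = (\<lambda>n. blinfun_apply f (z n))"
  unfolding eval_ell1_def by (rule Abs_ell1_inverse) (simp add: summingD)

lemma dist_eval_ell1: "summing z \<Longrightarrow> dist (eval_ell1 z f) (eval_ell1 z g) = l1_seminorm z (f - g)"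
  by (simp add: dist_norm norm_ell1.rep_eq minus_ell1.rep_eq ell1_nth_eval l1_seminorm_def blinfun.diff_left)

lemma eval_ell1_add: "summing z \<Longrightarrow> eval_ell1 z (f + g) = eval_ell1 z f + eval_ell1 z g"
  by (simp add: ell1_nth_inject[symmetric] plus_ell1.rep_eq ell1_nth_eval blinfun.add_left)

lemma eval_ell1_zero: "summing z \<Longrightarrow> eval_ell1 z 0 = 0"
  by (simp add: ell1_nth_inject[symmetric] zero_ell1.rep_eq ell1_nth_eval)

text \<open>Each compact set \<open>K\<close> contributes one factor: its dominating sequence \<open>z K\<close> gives a continuous map into
  \<open>\<ell>\<^sub>1\<close>, and functionals whose images are close in this factor are close on \<open>K\<close>.\<close>

lemma tau_k_embeds_ell1_power:
  assumes "script_L_infty TYPE('a::real_normed_vector)"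
  shows "isomorphic_to_subgroup_of
           (additive_group :: ('a \<Rightarrow>\<^sub>L real) monoid) tau_k
           (product_group {K :: 'a set. compact K} (\<lambda>_. additive_group :: ell1 monoid))
           (product_topology (\<lambda>_. euclidean) {K :: 'a set. compact K})"
proof -
  let ?I = "{K :: 'a set. compact K}"
  have "\<forall>K :: 'a set. \<exists>z. compact K \<longrightarrow> summing z \<and> (\<forall>f. \<forall>x\<in>K. \<bar>blinfun_apply f x\<bar> \<le> l1_seminorm z f)"
    using compact_dominated_by_summing_sequence[OF assms] by blast
  then obtain z where z: "\<And>K :: 'a set. compact K \<Longrightarrow> summing (z K)"
    "\<And>K f x. compact K \<Longrightarrow> x \<in> K \<Longrightarrow> \<bar>blinfun_apply f x\<bar> \<le> l1_seminorm (z K) f"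
    by metis
  let ?\<phi> = "\<lambda>f. \<lambda>K\<in>?I. eval_ell1 (z K) f"
  show ?thesis
  proof (rule tau_k_embeddingI[where \<phi> = ?\<phi>])
    show "monoid (product_group ?I (\<lambda>_. additive_group :: ell1 monoid))"
      by (intro group.is_monoid product_group group_additive_group)
    show "?\<phi> f \<in> carrier (product_group ?I (\<lambda>_. additive_group))" for f
      by (auto simp: additive_group_def)
    show "?\<phi> (f + g) = ?\<phi> f \<otimes>\<^bsub>product_group ?I (\<lambda>_. additive_group)\<^esub> ?\<phi> g" for f g
      by (auto simp: additive_group_def eval_ell1_add z)
    show "?\<phi> 0 = \<one>\<^bsub>product_group ?I (\<lambda>_. additive_group)\<^esub>"
      by (auto simp: additive_group_def eval_ell1_zero z)
    show "continuous_map tau_k (product_topology (\<lambda>_. euclidean) ?I) ?\<phi>"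
    proof (subst continuous_map_componentwise, intro conjI ballI)
      fix K assume "K \<in> ?I"
      then show "continuous_map tau_k euclidean (\<lambda>f. ?\<phi> f K)"
        using z(1)[of K] by (auto intro!: continuous_summing[of "z K"] simp: dist_eval_ell1)
    qed auto
    fix K :: "'a set" and f :: "'a \<Rightarrow>\<^sub>L real" assume K: "compact K"
    let ?T = "product_topology (\<lambda>_. euclidean :: ell1 topology) ?I"
    let ?V = "{p \<in> topspace ?T. p K \<in> ball (eval_ell1 (z K) f) 1}"
    have "openin ?T ?V"
      using K by (intro openin_continuous_map_preimage[OF continuous_map_product_projection]) auto
    moreover have "?\<phi> f \<in> ?V" using K by auto
    moreover have "\<bar>blinfun_apply g x - blinfun_apply f x\<bar> \<le> 1" if g: "?\<phi> g \<in> ?V" and x: "x \<in> K" for g :: "'a \<Rightarrow>\<^sub>L real" and x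
    proof -
      have "l1_seminorm (z K) (f - g) < 1"
        using g K by (simp add: dist_eval_ell1 z(1))
      then show ?thesis
        using z(2)[OF K x, of "f - g"] by (simp add: blinfun.diff_left abs_minus_commute)
    qed
    ultimately show "\<exists>V. openin ?T V \<and> ?\<phi> f \<in> V \<and> (\<forall>g :: 'a \<Rightarrow>\<^sub>L real. ?\<phi> g \<in> V \<longrightarrow> (\<forall>x\<in>K. \<bar>blinfun_apply g x - blinfun_apply f x\<bar> \<le> 1))"
      by blast
  qed
qed

section \<open>Positive definite kernels and formal linear combinations\<close>

text \<open>A formal linear combination of points is a list of pairs of a coefficient and a point. Lists serve
  better than finitely supported functions here, as the sum of two combinations is their concatenation and all
  sums over a combination are computed by recursion.\<close>

definition eval_comb :: "('x \<Rightarrow> complex) \<Rightarrow> (complex \<times> 'x) list \<Rightarrow> complex" where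
  "eval_comb F c = (\<Sum>(a, x)\<leftarrow>c. a * F x)"

definition scale_comb :: "complex \<Rightarrow> (complex \<times> 'x) list \<Rightarrow> (complex \<times> 'x) list" where
  "scale_comb t c = map (\<lambda>(a, x). (t * a, x)) c"

definition kernel_comb :: "('x \<Rightarrow> 'x \<Rightarrow> complex) \<Rightarrow> (complex \<times> 'x) list \<Rightarrow> 'x \<Rightarrow> complex" where
  "kernel_comb k c x = (\<Sum>(b, y)\<leftarrow>c. cnj b * k x y)"

text \<open>The sesquilinear form that the kernel \<open>k\<close> defines on formal combinations. The function \<open>kernel_comb k d\<close> will
  be the element of the Hilbert space of \<open>k\<close> that the combination \<open>d\<close> stands for, and evaluation at \<open>c\<close> will be
  the inner product with \<open>kernel_comb k c\<close>.\<close>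

definition gram :: "('x \<Rightarrow> 'x \<Rightarrow> complex) \<Rightarrow> (complex \<times> 'x) list \<Rightarrow> (complex \<times> 'x) list \<Rightarrow> complex" where
  "gram k c d = eval_comb (kernel_comb k d) c"

lemma eval_Nil [simp]: "eval_comb F [] = 0"
  and eval_Cons [simp]: "eval_comb F (p # c) = fst p * F (snd p) + eval_comb F c"
  and eval_append [simp]: "eval_comb F (c @ d) = eval_comb F c + eval_comb F d"
  by (simp_all add: eval_comb_def split_beta)

lemma scale_Nil [simp]: "scale_comb t [] = []"
  and scale_Cons [simp]: "scale_comb t (p # c) = (t * fst p, snd p) # scale_comb t c"
  and scale_append [simp]: "scale_comb t (c @ d) = scale_comb t c @ scale_comb t d"
  by (simp_all add: scale_comb_def split_beta)

lemma eval_scale [simp]: "eval_comb F (scale_comb t c) = t * eval_comb F c"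
  by (induction c) (simp_all add: algebra_simps)

lemma eval_add: "eval_comb (\<lambda>x. F x + G x) c = eval_comb F c + eval_comb G c"
  and eval_diff: "eval_comb (\<lambda>x. F x - G x) c = eval_comb F c - eval_comb G c"
  and eval_mult: "eval_comb (\<lambda>x. a * F x) c = a * eval_comb F c"
  and eval_zero [simp]: "eval_comb (\<lambda>x. 0) c = 0"
  by (induction c) (simp_all add: algebra_simps)

lemma kernel_comb_Nil [simp]: "kernel_comb k [] x = 0"
  and kernel_comb_Cons [simp]: "kernel_comb k (p # c) x = cnj (fst p) * k x (snd p) + kernel_comb k c x"
  and kernel_comb_append [simp]: "kernel_comb k (c @ d) x = kernel_comb k c x + kernel_comb k d x"
  by (simp_all add: kernel_comb_def split_beta)

lemma kernel_comb_scale [simp]: "kernel_comb k (scale_comb t c) x = cnj t * kernel_comb k c x"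
  by (induction c) (simp_all add: algebra_simps)

lemma gram_left [simp]: "gram k [] d = 0" "gram k (c @ c') d = gram k c d + gram k c' d"
    "gram k (scale_comb t c) d = t * gram k c d"
  by (simp_all add: gram_def)

lemma gram_right [simp]: "gram k c [] = 0" "gram k c (d @ d') = gram k c d + gram k c d'"
    "gram k c (scale_comb t d) = cnj t * gram k c d"
proof -
  have "kernel_comb k [] = (\<lambda>x. 0)" "kernel_comb k (d @ d') = (\<lambda>x. kernel_comb k d x + kernel_comb k d' x)"
    "kernel_comb k (scale_comb t d) = (\<lambda>x. cnj t * kernel_comb k d x)"
    by (simp_all add: fun_eq_iff)
  then show "gram k c [] = 0" "gram k c (d @ d') = gram k c d + gram k c d'"
    "gram k c (scale_comb t d) = cnj t * gram k c d"
    by (simp_all add: gram_def eval_add eval_mult)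
qed

lemma gram_Cons_left: "gram k (p # c) d = fst p * kernel_comb k d (snd p) + gram k c d"
  by (simp add: gram_def)

lemma tendsto_eval:
  assumes "\<And>x. ((\<lambda>n. F n x) \<longlongrightarrow> G x) T"
  shows "((\<lambda>n. eval_comb (F n) c) \<longlongrightarrow> eval_comb G c) T"
  by (induction c) (auto intro!: tendsto_intros assms)

definition pos_def :: "('x \<Rightarrow> 'x \<Rightarrow> complex) \<Rightarrow> bool" where
  "pos_def k \<longleftrightarrow> (\<forall>x y. k y x = cnj (k x y)) \<and> (\<forall>c. 0 \<le> Re (gram k c c))"

locale pd_kernel =
  fixes k :: "'x \<Rightarrow> 'x \<Rightarrow> complex"
  assumes pos_def: "pos_def k"
begin

lemma kernel_cnj: "cnj (k x y) = k y x"
  using pos_def unfolding pos_def_def by metis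

lemma gram_cnj: "gram k d c = cnj (gram k c d)"
proof (induction c)
  case Nil
  then show ?case by simp
next
  case (Cons p c)
  have 1: "gram k d [p] = cnj (fst p * kernel_comb k d (snd p))"
    by (induction d) (simp_all add: gram_Cons_left kernel_cnj algebra_simps)
  have "gram k d (p # c) = gram k d [p] + gram k d c"
    using gram_right(2)[of k d "[p]" c] by simp
  also have "\<dots> = cnj (gram k (p # c) d)"
    by (simp add: 1 Cons gram_Cons_left)
  finally show ?case .
qed

definition comb_norm :: "(complex \<times> 'x) list \<Rightarrow> real" where
  "comb_norm c = sqrt (Re (gram k c c))"

lemma gram_self_nonneg: "0 \<le> Re (gram k c c)"
  using pos_def unfolding pos_def_def by metis

lemma comb_norm_nonneg [simp]: "0 \<le> comb_norm c"
  by (simp add: comb_norm_def gram_self_nonneg)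

lemma comb_norm_sq: "(comb_norm c)\<^sup>2 = Re (gram k c c)"
  by (simp add: comb_norm_def gram_self_nonneg)

lemma gram_self: "gram k c c = of_real ((comb_norm c)\<^sup>2)"
  using arg_cong[OF gram_cnj[of c c], of Im] by (simp add: complex_eq_iff comb_norm_sq)

lemma comb_norm_scale: "comb_norm (scale_comb t c) = cmod t * comb_norm c"
proof -
  have "gram k (scale_comb t c) (scale_comb t c) = (t * cnj t) * gram k c c"
    by (simp add: mult_ac)
  also have "\<dots> = of_real ((cmod t)\<^sup>2 * (comb_norm c)\<^sup>2)"
    by (simp only: complex_norm_square gram_self of_real_mult)
  finally have "(comb_norm (scale_comb t c))\<^sup>2 = (cmod t * comb_norm c)\<^sup>2"
    by (simp only: comb_norm_sq Re_complex_of_real power_mult_distrib)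
  then show ?thesis
    by (simp add: power2_eq_iff_nonneg)
qed

lemma comb_norm_append_sq: "(comb_norm (c @ d))\<^sup>2 = (comb_norm c)\<^sup>2 + 2 * Re (gram k c d) + (comb_norm d)\<^sup>2"
  unfolding comb_norm_sq using gram_cnj[of c d] by simp

text \<open>The discriminant argument behind the Cauchy--Schwarz inequality: real multiples of \<open>d\<close> bound the real part
  of \<open>f d\<close>, and turning \<open>d\<close> by a complex number of modulus 1 makes \<open>f d\<close> real.\<close>

lemma quadratic_bound:
  assumes e: "0 \<le> e"
    and le: "\<And>d t::real. 2 * t * Re (f d) - t\<^sup>2 * (comb_norm d)\<^sup>2 \<le> e\<^sup>2"
    and f: "\<And>t d. f (scale_comb t d) = t * f d"
  shows "cmod (f d) \<le> e * comb_norm d"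
proof -
  obtain u where u: "cmod u = 1" "u * f d = of_real (cmod (f d))"
  proof (cases "f d = 0")
    case True
    then show ?thesis using that[of 1] by simp
  next
    case False
    have "cnj (sgn (f d)) * f d = of_real (cmod (f d))"
      using False by (simp add: sgn_eq complex_norm_square[symmetric] power2_eq_square
          mult.commute[of "cnj _"])
    moreover have "cmod (cnj (sgn (f d))) = 1"
      using False by (simp add: norm_sgn)
    ultimately show ?thesis using that by blast
  qed
  define r where "r = cmod (f d)"
  have key: "2 * t * r - t\<^sup>2 * (comb_norm d)\<^sup>2 \<le> e\<^sup>2" for t :: real
    using le[of t "scale_comb u d"] u by (simp add: f comb_norm_scale r_def)
  have "r \<le> e * comb_norm d"
  proof (cases "comb_norm d = 0")
    case True
    have "r \<le> 0"
    proof (rule ccontr)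
      assume "\<not> r \<le> 0"
      then show False
        using key[of "(e\<^sup>2 + 1) / (2 * r)"] True by (simp add: field_simps)
    qed
    then show ?thesis using True by simp
  next
    case False
    then have n: "0 < comb_norm d" using comb_norm_nonneg[of d] by linarith
    have "r\<^sup>2 \<le> (e * comb_norm d)\<^sup>2"
      using key[of "r / (comb_norm d)\<^sup>2"] n
      by (simp add: field_simps power2_eq_square)
    then show ?thesis
      using power2_le_imp_le e n by (metis mult_nonneg_nonneg comb_norm_nonneg)
  qed
  then show ?thesis by (simp add: r_def)
qed

lemma gram_le: "cmod (gram k c d) \<le> comb_norm c * comb_norm d"
proof -
  have "cmod (gram k d c) \<le> comb_norm c * comb_norm d" for d
  proof (rule quadratic_bound)
    fix d and t :: real
    have "0 \<le> (comb_norm (c @ scale_comb (of_real (- t)) d))\<^sup>2" by simp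
    also have "\<dots> = (comb_norm c)\<^sup>2 - 2 * t * Re (gram k c d) + t\<^sup>2 * (comb_norm d)\<^sup>2"
      by (simp add: comb_norm_append_sq comb_norm_scale power_mult_distrib)
    finally show "2 * t * Re (gram k d c) - t\<^sup>2 * (comb_norm d)\<^sup>2 \<le> (comb_norm c)\<^sup>2"
      using gram_cnj[of c d] by simp
  qed simp_all
  then show ?thesis
    using gram_cnj[of c d] by (metis complex_mod_cnj)
qed

section \<open>The Hilbert space of a positive definite kernel\<close>

text \<open>The reproducing kernel Hilbert space is realised as the set of all functions whose extension to formal
  combinations is bounded with respect to the seminorm of the kernel, that is, as the dual of a pre-Hilbert space.
  In this form it consists of functions on \<open>'x\<close>, and its completeness is that of a space of bounded functionals.
  What has to be proved is that the kernel functions are dense, which then yields the inner product.\<close>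

definition bounded_by :: "real \<Rightarrow> ('x \<Rightarrow> complex) \<Rightarrow> bool" where
  "bounded_by M F \<longleftrightarrow> 0 \<le> M \<and> (\<forall>c. cmod (eval_comb F c) \<le> M * comb_norm c)"

definition rkhs :: "('x \<Rightarrow> complex) set" where
  "rkhs = {F. \<exists>M. bounded_by M F}"

lemma bdD: "bounded_by M F \<Longrightarrow> cmod (eval_comb F c) \<le> M * comb_norm c"
  and bounded_by_nonneg: "bounded_by M F \<Longrightarrow> 0 \<le> M"
  by (auto simp: bounded_by_def)

lemma bounded_by_add: "bounded_by M F \<Longrightarrow> bounded_by N G \<Longrightarrow> bounded_by (M + N) (\<lambda>x. F x + G x)"
  by (auto simp: bounded_by_def eval_add distrib_right intro!: norm_triangle_le add_mono)

lemma bounded_by_mult: "bounded_by M F \<Longrightarrow> bounded_by (cmod a * M) (\<lambda>x. a * F x)"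
  by (auto simp: bounded_by_def eval_mult norm_mult mult.assoc intro!: mult_left_mono)

lemma bounded_by_diff: "bounded_by M F \<Longrightarrow> bounded_by N G \<Longrightarrow> bounded_by (M + N) (\<lambda>x. F x - G x)"
  using bounded_by_add[of M F N "\<lambda>x. (-1) * G x"] bounded_by_mult[of N G "-1"] by simp

lemma bounded_by_minus_commute: "bounded_by M (\<lambda>x. F x - G x) \<Longrightarrow> bounded_by M (\<lambda>x. G x - F x)"
  using bounded_by_mult[of M "\<lambda>x. F x - G x" "-1"] by simp

lemma bounded_by_mono: "bounded_by M F \<Longrightarrow> M \<le> N \<Longrightarrow> bounded_by N F"
  by (auto simp: bounded_by_def intro: order_trans[OF _ mult_right_mono])

lemma bounded_by_kernel_comb: "bounded_by (comb_norm c) (kernel_comb k c)"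
  using gram_le by (auto simp: bounded_by_def gram_def[symmetric] mult.commute)

lemma comb_norm_le_of_bounded_by: 
  assumes "bounded_by M (kernel_comb k c)" shows "comb_norm c \<le> M"
proof (rule ccontr)
  assume less: "\<not> comb_norm c \<le> M"
  have "cmod (gram k c c) \<le> M * comb_norm c"
    using bdD[OF assms, of c] by (simp add: gram_def)
  then have "comb_norm c * comb_norm c \<le> M * comb_norm c"
    by (simp add: gram_self power2_eq_square norm_mult)
  with less bounded_by_nonneg[OF assms] show False by simp
qed

lemma kernel_comb_diff: "kernel_comb k (c @ scale_comb (- 1) d) = (\<lambda>x. kernel_comb k c x - kernel_comb k d x)"
  by auto

text \<open>The Riesz argument: the concave functional \<open>v c = 2 Re F(c) - \<parallel>c\<parallel>\<^sup>2\<close> is bounded above, and its maximum would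
  be attained exactly at a combination representing \<open>F\<close>. At a combination where the supremum is missed by less
  than \<open>e\<^sup>2\<close>, comparison with all \<open>c + t d\<close> leaves an error of norm at most \<open>e\<close>.\<close>

lemma approx:
  assumes F: "F \<in> rkhs" and e: "0 < e"
  obtains c where "bounded_by e (\<lambda>x. F x - kernel_comb k c x)"
proof -
  obtain M where M: "bounded_by M F" using F by (auto simp: rkhs_def)
  define v where "v c = 2 * Re (eval_comb F c) - (comb_norm c)\<^sup>2" for c
  have v_le: "v c \<le> M\<^sup>2" for c
  proof -
    have "Re (eval_comb F c) \<le> M * comb_norm c"
      using bdD[OF M, of c] complex_Re_le_cmod order_trans by blast
    moreover have "0 \<le> (M - comb_norm c)\<^sup>2" by simp
    ultimately show ?thesis
      unfolding v_def power2_diff by linarith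
  qed
  have bdd: "bdd_above (range v)" using v_le by (auto simp: bdd_above_def)
  have "Sup (range v) - e\<^sup>2 < Sup (range v)" using e by simp
  then obtain c where c: "Sup (range v) - e\<^sup>2 < v c"
    using less_cSup_iff[OF _ bdd] by auto
  have sup: "v d \<le> Sup (range v)" for d
    by (rule cSup_upper[OF _ bdd]) simp
  have "cmod (eval_comb F d - gram k d c) \<le> e * comb_norm d" for d
  proof (rule quadratic_bound)
    fix d and t :: real
    have "v (c @ scale_comb (of_real t) d) \<le> v c + e\<^sup>2"
      using sup[of "c @ scale_comb (of_real t) d"] c by linarith
    then show "2 * t * Re (eval_comb F d - gram k d c) - t\<^sup>2 * (comb_norm d)\<^sup>2 \<le> e\<^sup>2"
      unfolding v_def using gram_cnj[of c d]
      by (simp add: comb_norm_append_sq comb_norm_scale power_mult_distrib algebra_simps)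
  qed (use e in \<open>simp_all add: algebra_simps\<close>)
  then have "bounded_by e (\<lambda>x. F x - kernel_comb k c x)"
    using e by (simp add: bounded_by_def eval_diff gram_def)
  then show thesis by (rule that)
qed

definition approximated_by :: "('x \<Rightarrow> complex) \<Rightarrow> (nat \<Rightarrow> (complex \<times> 'x) list) \<Rightarrow> bool" where
  "approximated_by F c \<longleftrightarrow> (\<exists>e. e \<longlonglongrightarrow> 0 \<and> (\<forall>n. bounded_by (e n) (\<lambda>x. F x - kernel_comb k (c n) x)))"

lemma approximated_by_exists:
  assumes "F \<in> rkhs" shows "\<exists>c. approximated_by F c"
proof -
  have "\<exists>c. bounded_by (inverse (real (Suc n))) (\<lambda>x. F x - kernel_comb k c x)" for n
    using approx[OF assms, of "inverse (real (Suc n))"] by (metis inverse_positive_iff_positive of_nat_0_less_iff zero_less_Suc)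
  then obtain c where "\<forall>n. bounded_by (inverse (real (Suc n))) (\<lambda>x. F x - kernel_comb k (c n) x)"
    by metis
  then show ?thesis
    unfolding approximated_by_def using LIMSEQ_inverse_real_of_nat by blast
qed

lemma approximated_by_diff_null:
  assumes "approximated_by G c" "approximated_by G d"
  shows "(\<lambda>n. comb_norm (c n @ scale_comb (- 1) (d n))) \<longlonglongrightarrow> 0"
proof -
  obtain e e' where e: "e \<longlonglongrightarrow> 0" "\<And>n. bounded_by (e n) (\<lambda>x. G x - kernel_comb k (c n) x)"
    and e': "e' \<longlonglongrightarrow> 0" "\<And>n. bounded_by (e' n) (\<lambda>x. G x - kernel_comb k (d n) x)"
    using assms unfolding approximated_by_def by blast
  have le: "comb_norm (c n @ scale_comb (- 1) (d n)) \<le> e' n + e n" for n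
    using bounded_by_diff[OF e'(2)[of n] e(2)[of n]]
    by (intro comb_norm_le_of_bounded_by) (simp add: kernel_comb_diff)
  show ?thesis
    by (rule tendsto_sandwich[of "\<lambda>_. 0" _ _ "\<lambda>n. e' n + e n"])
       (use le tendsto_add[OF e'(1) e(1)] in \<open>simp_all\<close>)
qed

lemma approximated_by_limit_null:
  assumes F: "F \<in> rkhs" and "approximated_by G c" "approximated_by G d"
  shows "(\<lambda>n. eval_comb F (c n) - eval_comb F (d n)) \<longlonglongrightarrow> 0"
proof -
  obtain M where M: "bounded_by M F" using F by (auto simp: rkhs_def)
  have "norm (eval_comb F (c n) - eval_comb F (d n)) \<le> M * comb_norm (c n @ scale_comb (- 1) (d n))" for n
    using bdD[OF M, of "c n @ scale_comb (- 1) (d n)"] by simp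
  then have "\<forall>\<^sub>F n in sequentially. norm (eval_comb F (c n) - eval_comb F (d n)) \<le> M * comb_norm (c n @ scale_comb (- 1) (d n))"
    by simp
  then show ?thesis
    by (rule Lim_null_comparison) (rule tendsto_mult_right_zero[OF approximated_by_diff_null[OF assms(2,3)]])
qed

lemma approximated_by_convergent:
  assumes F: "F \<in> rkhs" and c: "approximated_by G c"
  shows "convergent (\<lambda>n. eval_comb F (c n))"
proof -
  obtain M where M: "bounded_by M F" using F by (auto simp: rkhs_def)
  obtain e where e: "e \<longlonglongrightarrow> 0" "\<And>n. bounded_by (e n) (\<lambda>x. G x - kernel_comb k (c n) x)"
    using c unfolding approximated_by_def by blast
  have le: "dist (eval_comb F (c m)) (eval_comb F (c n)) \<le> M * (e n + e m)" for m n
  proof -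
    have "comb_norm (c m @ scale_comb (- 1) (c n)) \<le> e n + e m"
      using bounded_by_diff[OF e(2)[of n] e(2)[of m]]
      by (intro comb_norm_le_of_bounded_by) (simp add: kernel_comb_diff)
    then have "M * comb_norm (c m @ scale_comb (- 1) (c n)) \<le> M * (e n + e m)"
      using bounded_by_nonneg[OF M] by (rule mult_left_mono)
    then show ?thesis
      using bdD[OF M, of "c m @ scale_comb (- 1) (c n)"] by (simp add: dist_norm)
  qed
  have Me: "(\<lambda>n. M * e n) \<longlonglongrightarrow> 0"
    by (rule tendsto_mult_right_zero[OF e(1)])
  have "Cauchy (\<lambda>n. eval_comb F (c n))"
  proof (rule metric_CauchyI)
    fix r :: real assume "0 < r"
    then have "\<forall>\<^sub>F n in sequentially. M * e n < r / 2"
      using order_tendstoD(2)[OF Me, of "r / 2"] by simp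
    then obtain N where N: "\<And>n. n \<ge> N \<Longrightarrow> M * e n < r / 2"
      by (auto simp: eventually_sequentially)
    have "dist (eval_comb F (c m)) (eval_comb F (c n)) < r" if "m \<ge> N" "n \<ge> N" for m n
      using le[of m n] N[OF that(1)] N[OF that(2)] by (simp add: algebra_simps)
    then show "\<exists>N. \<forall>m\<ge>N. \<forall>n\<ge>N. dist (eval_comb F (c m)) (eval_comb F (c n)) < r" by blast
  qed
  then show ?thesis by (simp add: Cauchy_convergent_iff)
qed

text \<open>The sequence chosen for \<open>G\<close> does not matter by \<open>approximated_by_limit_null\<close>. Evaluating \<open>F\<close>,
  instead of pairing two approximating sequences, makes linearity in \<open>F\<close> immediate.\<close>

definition rkhs_inner :: "('x \<Rightarrow> complex) \<Rightarrow> ('x \<Rightarrow> complex) \<Rightarrow> complex" where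
  "rkhs_inner F G = lim (\<lambda>n. eval_comb F ((SOME c. approximated_by G c) n))"

lemma rkhs_inner_limit:
  assumes F: "F \<in> rkhs" and c: "approximated_by G c"
  shows "(\<lambda>n. eval_comb F (c n)) \<longlonglongrightarrow> rkhs_inner F G"
proof -
  let ?d = "SOME c. approximated_by G c"
  have d: "approximated_by G ?d" using someI[of "approximated_by G", OF c] .
  have "(\<lambda>n. eval_comb F (?d n)) \<longlonglongrightarrow> rkhs_inner F G"
    unfolding rkhs_inner_def using approximated_by_convergent[OF F d] by (rule convergent_LIMSEQ_iff[THEN iffD1])
  from tendsto_add[OF approximated_by_limit_null[OF F c d] this] show ?thesis by simp
qed

lemma rkhs_add: "F \<in> rkhs \<Longrightarrow> G \<in> rkhs \<Longrightarrow> (\<lambda>x. F x + G x) \<in> rkhs"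
  unfolding rkhs_def using bounded_by_add by blast

lemma rkhs_diff: "F \<in> rkhs \<Longrightarrow> G \<in> rkhs \<Longrightarrow> (\<lambda>x. F x - G x) \<in> rkhs"
  unfolding rkhs_def using bounded_by_diff by blast

lemma rkhs_mult: "F \<in> rkhs \<Longrightarrow> (\<lambda>x. a * F x) \<in> rkhs"
  unfolding rkhs_def using bounded_by_mult by blast

lemma rkhs_kernel_comb: "kernel_comb k c \<in> rkhs"
  unfolding rkhs_def using bounded_by_kernel_comb by blast

lemma rkhs_zero: "(\<lambda>_. 0) \<in> rkhs"
  unfolding rkhs_def by (auto simp: bounded_by_def intro: exI[of _ 0])

lemma rkhs_inner_add:
  assumes F: "F \<in> rkhs" and F': "F' \<in> rkhs" and G: "G \<in> rkhs"
  shows "rkhs_inner (\<lambda>x. F x + F' x) G = rkhs_inner F G + rkhs_inner F' G"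
proof -
  obtain c where c: "approximated_by G c" using approximated_by_exists[OF G] by blast
  show ?thesis
    using LIMSEQ_unique[OF rkhs_inner_limit[OF rkhs_add[OF F F'] c, unfolded eval_add]
        tendsto_add[OF rkhs_inner_limit[OF F c] rkhs_inner_limit[OF F' c]]] .
qed

lemma rkhs_inner_mult:
  assumes F: "F \<in> rkhs" and G: "G \<in> rkhs"
  shows "rkhs_inner (\<lambda>x. a * F x) G = a * rkhs_inner F G"
proof -
  obtain c where c: "approximated_by G c" using approximated_by_exists[OF G] by blast
  show ?thesis
    using LIMSEQ_unique[OF rkhs_inner_limit[OF rkhs_mult[OF F] c, unfolded eval_mult]
        tendsto_mult_left[OF rkhs_inner_limit[OF F c]]] .
qed

lemma approximated_by_comb_norm_bounded:
  assumes "bounded_by M F" "approximated_by F c"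
  obtains e where "e \<longlonglongrightarrow> 0" "\<And>n. bounded_by (e n) (\<lambda>x. F x - kernel_comb k (c n) x)" "\<And>n. comb_norm (c n) \<le> M + e n"
proof -
  obtain e where e: "e \<longlonglongrightarrow> 0" "\<And>n. bounded_by (e n) (\<lambda>x. F x - kernel_comb k (c n) x)"
    using assms unfolding approximated_by_def by blast
  have "comb_norm (c n) \<le> M + e n" for n
    using bounded_by_diff[OF assms(1) e(2)[of n]] by (intro comb_norm_le_of_bounded_by) simp
  with e show thesis using that by blast
qed

text \<open>Seen as a limit of values of the hermitian form \<^const>\<open>gram\<close>, the inner product is hermitian and
  nonnegative.\<close>

lemma rkhs_inner_limit_gram:
  assumes F: "F \<in> rkhs" and G: "G \<in> rkhs" and c: "approximated_by F c" and d: "approximated_by G d"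
  shows "(\<lambda>n. gram k (d n) (c n)) \<longlonglongrightarrow> rkhs_inner F G"
proof -
  obtain M where M: "bounded_by M G" using G by (auto simp: rkhs_def)
  obtain e where e: "e \<longlonglongrightarrow> 0" "\<And>n. comb_norm (d n) \<le> M + e n"
    using approximated_by_comb_norm_bounded[OF M d] by metis
  obtain e' where e': "e' \<longlonglongrightarrow> 0" "\<And>n. bounded_by (e' n) (\<lambda>x. F x - kernel_comb k (c n) x)"
    using c unfolding approximated_by_def by blast
  have le: "norm (gram k (d n) (c n) - eval_comb F (d n)) \<le> e' n * (M + e n)" for n
    using bdD[OF e'(2)[of n], of "d n"] mult_left_mono[OF e(2)[of n] bounded_by_nonneg[OF e'(2)[of n]]]
    by (simp add: eval_diff gram_def norm_minus_commute)
  have "(\<lambda>n. e' n * (M + e n)) \<longlonglongrightarrow> 0 * (M + 0)"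
    by (intro tendsto_intros e e')
  then have "(\<lambda>n. gram k (d n) (c n) - eval_comb F (d n)) \<longlonglongrightarrow> 0"
    by (intro Lim_null_comparison[OF always_eventually[OF allI[OF le]]]) simp
  from tendsto_add[OF this rkhs_inner_limit[OF F d]] show ?thesis by simp
qed

lemma rkhs_inner_cnj:
  assumes "F \<in> rkhs" "G \<in> rkhs" shows "rkhs_inner G F = cnj (rkhs_inner F G)"
proof -
  obtain c d where c: "approximated_by F c" and d: "approximated_by G d" using approximated_by_exists assms by metis
  have "(\<lambda>n. cnj (gram k (d n) (c n))) \<longlonglongrightarrow> cnj (rkhs_inner F G)"
    by (intro tendsto_intros rkhs_inner_limit_gram assms c d)
  then have "(\<lambda>n. gram k (c n) (d n)) \<longlonglongrightarrow> cnj (rkhs_inner F G)"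
    by (simp only: gram_cnj[symmetric])
  with rkhs_inner_limit_gram[OF assms(2,1) d c] show ?thesis by (rule LIMSEQ_unique)
qed

lemma rkhs_inner_self_limit:
  assumes "F \<in> rkhs" "approximated_by F c"
  shows "(\<lambda>n. (comb_norm (c n))\<^sup>2) \<longlonglongrightarrow> Re (rkhs_inner F F)"
  using tendsto_Re[OF rkhs_inner_limit_gram[OF assms(1,1) assms(2,2)]] by (simp add: comb_norm_sq)

lemma rkhs_inner_nonneg: assumes F: "F \<in> rkhs" shows "0 \<le> Re (rkhs_inner F F)"
proof -
  obtain c where c: "approximated_by F c" using approximated_by_exists[OF F] by blast
  show ?thesis by (rule LIMSEQ_le_const[OF rkhs_inner_self_limit[OF F c]]) simp
qed

definition rkhs_norm :: "('x \<Rightarrow> complex) \<Rightarrow> real" where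
  "rkhs_norm F = sqrt (Re (rkhs_inner F F))"

lemma rkhs_norm_limit:
  assumes "F \<in> rkhs" "approximated_by F c" shows "(\<lambda>n. comb_norm (c n)) \<longlonglongrightarrow> rkhs_norm F"
  using tendsto_real_sqrt[OF rkhs_inner_self_limit[OF assms]] by (simp add: rkhs_norm_def)

lemma rkhs_norm_le: assumes "bounded_by M F" shows "rkhs_norm F \<le> M"
proof -
  have F: "F \<in> rkhs" using assms by (auto simp: rkhs_def)
  obtain c where c: "approximated_by F c" using approximated_by_exists[OF F] by blast
  obtain e where e: "e \<longlonglongrightarrow> 0" "\<And>n. comb_norm (c n) \<le> M + e n"
    using approximated_by_comb_norm_bounded[OF assms c] by metis
  show ?thesis
    by (rule LIMSEQ_le[OF rkhs_norm_limit[OF F c], of "\<lambda>n. M + e n"])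
       (use e tendsto_add[OF tendsto_const e(1), of M] in auto)
qed

lemma rkhs_norm_nonneg: "F \<in> rkhs \<Longrightarrow> 0 \<le> rkhs_norm F"
  by (simp add: rkhs_norm_def rkhs_inner_nonneg)

lemma bounded_by_rkhs_norm: assumes F: "F \<in> rkhs" shows "bounded_by (rkhs_norm F) F"
proof -
  obtain c where c: "approximated_by F c" using approximated_by_exists[OF F] by blast
  obtain e where e: "e \<longlonglongrightarrow> 0" "\<And>n. bounded_by (e n) (\<lambda>x. F x - kernel_comb k (c n) x)"
    using c unfolding approximated_by_def by blast
  have "cmod (eval_comb F d) \<le> rkhs_norm F * comb_norm d" for d
  proof -
    have "cmod (eval_comb F d) \<le> (e n + comb_norm (c n)) * comb_norm d" for n
      using bdD[OF bounded_by_add[OF e(2)[of n] bounded_by_kernel_comb[of "c n"]], of d] by simp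
    moreover have "(\<lambda>n. (e n + comb_norm (c n)) * comb_norm d) \<longlonglongrightarrow> (0 + rkhs_norm F) * comb_norm d"
      by (intro tendsto_intros e rkhs_norm_limit[OF F c])
    ultimately show ?thesis
      using LIMSEQ_le_const[of "\<lambda>n. (e n + comb_norm (c n)) * comb_norm d"] by auto
  qed
  with F show ?thesis by (simp add: bounded_by_def rkhs_norm_nonneg)
qed

lemma rkhs_norm_eq_0: assumes "F \<in> rkhs" "rkhs_norm F = 0" shows "F = (\<lambda>_. 0)"
proof
  fix x show "F x = 0" using bdD[OF bounded_by_rkhs_norm[OF assms(1)], of "[(1, x)]"] assms(2) by simp
qed

text \<open>A Cauchy sequence converges pointwise because evaluation at a point is bounded, and the bounds on its
  differences, being conditions on values at combinations, pass to the pointwise limit.\<close>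

lemma rkhs_complete:
  assumes F: "\<And>n::nat. F n \<in> rkhs"
    and C: "\<And>r. 0 < r \<Longrightarrow> \<exists>N. \<forall>m\<ge>N. \<forall>n\<ge>N. rkhs_norm (\<lambda>x. F m x - F n x) < r"
  shows "\<exists>G\<in>rkhs. \<forall>r>0. \<exists>N. \<forall>n\<ge>N. rkhs_norm (\<lambda>x. F n x - G x) < r"
proof -
  have bounded_by_diff: "bounded_by r (\<lambda>x. F m x - F n x)" if "rkhs_norm (\<lambda>x. F m x - F n x) < r" for m n r
    using bounded_by_mono[OF bounded_by_rkhs_norm[OF rkhs_diff[OF F F]]] that by (simp add: less_imp_le)
  have "\<exists>l. (\<lambda>n. F n x) \<longlonglongrightarrow> l" for x
  proof -
    define s where "s = comb_norm [(1, x)] + 1"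
    have s: "0 < s" "comb_norm [(1, x)] \<le> s" by (simp_all add: s_def add_nonneg_pos)
    have "Cauchy (\<lambda>n. F n x)"
    proof (rule metric_CauchyI)
      fix r :: real assume r: "0 < r"
      obtain N where N: "\<And>m n. m \<ge> N \<Longrightarrow> n \<ge> N \<Longrightarrow> rkhs_norm (\<lambda>x. F m x - F n x) < r / 2 / s"
        using C[of "r / 2 / s"] r s by auto
      have "dist (F m x) (F n x) < r" if "m \<ge> N" "n \<ge> N" for m n
      proof -
        have "cmod (F m x - F n x) \<le> r / 2 / s * comb_norm [(1, x)]"
          using bdD[OF bounded_by_diff[OF N[OF that]], of "[(1, x)]"] by simp
        also have "\<dots> \<le> r / 2 / s * s"
          using s r by (intro mult_left_mono) auto
        also have "\<dots> < r" using s r by simp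
        finally show ?thesis by (simp add: dist_norm)
      qed
      then show "\<exists>N. \<forall>m\<ge>N. \<forall>n\<ge>N. dist (F m x) (F n x) < r" by blast
    qed
    then show ?thesis by (simp add: Cauchy_convergent_iff convergent_def)
  qed
  then obtain G where G: "\<And>x. (\<lambda>n. F n x) \<longlonglongrightarrow> G x" by metis
  have lim: "\<exists>N. \<forall>n\<ge>N. bounded_by r (\<lambda>x. F n x - G x)" if r: "0 < r" for r
  proof -
    obtain N where N: "\<And>m n. m \<ge> N \<Longrightarrow> n \<ge> N \<Longrightarrow> rkhs_norm (\<lambda>x. F m x - F n x) < r"
      using C[OF r] by auto
    have "cmod (eval_comb (\<lambda>x. F n x - G x) c) \<le> r * comb_norm c" if n: "n \<ge> N" for n c
    proof -
      have "(\<lambda>m. cmod (eval_comb (\<lambda>x. F n x - F m x) c)) \<longlonglongrightarrow> cmod (eval_comb (\<lambda>x. F n x - G x) c)"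
        by (intro tendsto_intros tendsto_eval G)
      moreover have "cmod (eval_comb (\<lambda>x. F n x - F m x) c) \<le> r * comb_norm c" if "m \<ge> N" for m
        using bdD[OF bounded_by_diff[OF N[OF n that]]] .
      ultimately show ?thesis using LIMSEQ_le_const2 by blast
    qed
    then show ?thesis using r by (auto simp: bounded_by_def)
  qed
  obtain N where "bounded_by 1 (\<lambda>x. F N x - G x)" using lim[of 1] by auto
  then have "(\<lambda>x. F N x - G x) \<in> rkhs" by (auto simp: rkhs_def)
  from rkhs_diff[OF F[of N] this] have GS: "G \<in> rkhs" by simp
  have "\<exists>N. \<forall>n\<ge>N. rkhs_norm (\<lambda>x. F n x - G x) < r" if r: "0 < r" for r
  proof -
    obtain N where N: "\<And>n. n \<ge> N \<Longrightarrow> bounded_by (r / 2) (\<lambda>x. F n x - G x)"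
      using lim[of "r / 2"] r by auto
    have "rkhs_norm (\<lambda>x. F n x - G x) < r" if "n \<ge> N" for n
      using rkhs_norm_le[OF N[OF that]] r by simp
    then show ?thesis by blast
  qed
  with GS show ?thesis by blast
qed

end

section \<open>Positive definiteness of the exponential of an \<open>\<ell>\<^sub>1\<close>-distance\<close>

lemma gram_weighted:
  "gram (\<lambda>x y. of_real (h x * h y) * A x y) c d =
   gram A (map (\<lambda>(a, x). (a * of_real (h x), x)) c) (map (\<lambda>(a, x). (a * of_real (h x), x)) d)"
proof -
  have "kernel_comb (\<lambda>x y. of_real (h x * h y) * A x y) d x =
      of_real (h x) * kernel_comb A (map (\<lambda>(a, x). (a * of_real (h x), x)) d) x" for x
    by (induction d) (auto simp: algebra_simps)
  then show ?thesis
    by (induction c) (auto simp: gram_Cons_left algebra_simps)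
qed

text \<open>The only products of kernels that are needed are with \<open>h x * h y\<close>, for which the form of the product at a
  combination is the form of \<open>A\<close> at the combination reweighted by \<open>h\<close>. Sums, integrals and limits of such
  products replace the Schur product theorem.\<close>

lemma pos_def_feature:
  fixes h :: "'x \<Rightarrow> real"
  assumes "pos_def A" shows "pos_def (\<lambda>x y. of_real (h x * h y) * A x y)"
  unfolding pos_def_def
proof (intro conjI allI)
  fix x y show "of_real (h y * h x) * A y x = cnj (of_real (h x * h y) * A x y)"
    using assms unfolding pos_def_def by (metis complex_cnj_complex_of_real complex_cnj_mult mult.commute)
next
  fix c show "0 \<le> Re (gram (\<lambda>x y. of_real (h x * h y) * A x y) c c)"
    using assms unfolding pos_def_def gram_weighted by blast
qed

lemma pos_def_one: "pos_def (\<lambda>(x :: 'x) y. 1)"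
proof -
  have k: "kernel_comb (\<lambda>x y. 1) d x = cnj (eval_comb (\<lambda>_. 1) d)" for d and x :: 'x
    by (induction d) simp_all
  have "gram (\<lambda>x y. 1) c d = eval_comb (\<lambda>_. 1) c * cnj (eval_comb (\<lambda>_. 1) d)" for c d :: "(complex \<times> 'x) list"
    by (induction c) (simp_all add: gram_Cons_left k algebra_simps)
  then show ?thesis by (simp add: pos_def_def)
qed

lemma kernel_comb_tendsto:
  assumes "\<And>x y. ((\<lambda>n. A n x y) \<longlongrightarrow> B x y) F"
  shows "((\<lambda>n. kernel_comb (A n) d x) \<longlongrightarrow> kernel_comb B d x) F"
  by (induction d) (auto intro!: tendsto_intros assms)

lemma gram_tendsto:
  assumes "\<And>x y. ((\<lambda>n. A n x y) \<longlongrightarrow> B x y) F"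
  shows "((\<lambda>n. gram (A n) c d) \<longlongrightarrow> gram B c d) F"
  by (induction c) (auto simp: gram_Cons_left intro!: tendsto_intros kernel_comb_tendsto assms)

lemma pos_def_limit:
  assumes A: "\<And>n. pos_def (A n)" and lim: "\<And>x y. ((\<lambda>n. A n x y) \<longlongrightarrow> B x y) F"
    and F: "F \<noteq> bot"
  shows "pos_def B"
  unfolding pos_def_def
proof (intro conjI allI)
  fix x y
  have "A n y x = cnj (A n x y)" for n using A[of n] unfolding pos_def_def by blast
  then have "((\<lambda>n. A n y x) \<longlongrightarrow> cnj (B x y)) F"
    using tendsto_cnj[OF lim[of x y]] by simp
  then show "B y x = cnj (B x y)" using tendsto_unique[OF F lim] by blast
next
  fix c
  have "((\<lambda>n. Re (gram (A n) c c)) \<longlongrightarrow> Re (gram B c c)) F"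
    by (intro tendsto_intros gram_tendsto lim)
  then show "0 \<le> Re (gram B c c)"
    by (rule tendsto_lowerbound) (use A F in \<open>auto simp: pos_def_def\<close>)
qed

lemma pos_def_add:
  assumes "pos_def A" "pos_def B" shows "pos_def (\<lambda>x y. A x y + B x y)"
proof -
  have "kernel_comb (\<lambda>x y. A x y + B x y) d x = kernel_comb A d x + kernel_comb B d x" for d x
    by (induction d) (simp_all add: algebra_simps)
  then have "gram (\<lambda>x y. A x y + B x y) c d = gram A c d + gram B c d" for c d
    by (induction c) (simp_all add: gram_Cons_left algebra_simps)
  with assms show ?thesis
    unfolding pos_def_def by (metis add_nonneg_nonneg complex_cnj_add plus_complex.sel(1))
qed

lemma pos_def_zero: "pos_def (\<lambda>x y. 0)"
  using pos_def_feature[OF pos_def_one, of "\<lambda>_. 0"] by simp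

lemma pos_def_sum:
  "finite V \<Longrightarrow> (\<And>v. v \<in> V \<Longrightarrow> pos_def (A v)) \<Longrightarrow> pos_def (\<lambda>x y. \<Sum>v\<in>V. A v x y)"
  by (induction V rule: finite_induct) (simp_all add: pos_def_zero pos_def_add)

text \<open>The equality of \<open>p x\<close> and \<open>p y\<close> is the sum over \<open>v\<close> of the products of the indicators of \<open>p x = v\<close> and
  \<open>p y = v\<close>; the sum over all \<open>v\<close> is taken as a limit along the finite sets of values.\<close>

lemma pos_def_blocks:
  assumes A: "pos_def A"
  shows "pos_def (\<lambda>x y. if p x = p y then A x y else 0)"
proof (rule pos_def_limit[where F = "finite_subsets_at_top UNIV"])
  let ?i = "\<lambda>v x. of_bool (p x = v) :: real"
  let ?A = "\<lambda>V x y. \<Sum>v\<in>V. of_real (?i v x * ?i v y) * A x y"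
  show "pos_def (?A V)" for V
    by (cases "finite V") (auto intro!: pos_def_sum pos_def_feature A pos_def_zero simp del: of_real_mult)
  fix x y
  have "?A V x y = (if p x = p y then A x y else 0)" if V: "finite V" "{p x} \<subseteq> V" for V
  proof -
    have "?A V x y = (\<Sum>v\<in>V. if v = p x then (if p x = p y then A x y else 0) else 0)"
      using V by (intro sum.cong) auto
    then show ?thesis using V by simp
  qed
  then show "((\<lambda>V. ?A V x y) \<longlongrightarrow> (if p x = p y then A x y else 0)) (finite_subsets_at_top UNIV)"
    by (intro tendsto_eventually)
       (auto simp only: eventually_finite_subsets_at_top intro!: exI[of _ "{p x}"])
qed simp

lemma pos_def_integral:
  fixes A :: "real \<Rightarrow> 'x \<Rightarrow> 'x \<Rightarrow> complex"
  assumes A: "\<And>u. pos_def (A u)" and int: "\<And>x y. ((\<lambda>u. A u x y) has_integral B x y) S"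
  shows "pos_def B"
  unfolding pos_def_def
proof (intro conjI allI)
  fix x y
  have "A u y x = cnj (A u x y)" for u using A[of u] unfolding pos_def_def by blast
  then have "((\<lambda>u. A u y x) has_integral cnj (B x y)) S"
    using has_integral_cnj[THEN iffD2, OF int[of x y]] by (simp add: comp_def)
  then show "B y x = cnj (B x y)" using has_integral_unique int by blast
next
  fix c
  have k: "((\<lambda>u. kernel_comb (A u) d x) has_integral kernel_comb B d x) S" for d x
    by (induction d) (auto intro!: has_integral_add has_integral_mult_right int)
  have "((\<lambda>u. gram (A u) c d) has_integral gram B c d) S" for d
    by (induction c) (auto simp: gram_Cons_left intro!: has_integral_add has_integral_mult_right k)
  then have "((\<lambda>u. Re (gram (A u) c c)) has_integral Re (gram B c c)) S"
    by (rule has_integral_Re)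
  then show "0 \<le> Re (gram B c c)"
    by (rule has_integral_nonneg) (use A in \<open>auto simp: pos_def_def\<close>)
qed

text \<open>The triangle function of \<open>h x - h y\<close> is the length of the intersection of the unit intervals starting at
  \<open>h x\<close> and \<open>h y\<close>, hence the integral over \<open>u\<close> of the product of the indicators of \<open>u\<close> lying in either.\<close>

lemma pos_def_triangle:
  fixes h :: "'x \<Rightarrow> real"
  assumes A: "pos_def A"
  shows "pos_def (\<lambda>x y. of_real (max 0 (1 - \<bar>h x - h y\<bar>)) * A x y)"
proof (rule pos_def_integral[where S = UNIV])
  let ?i = "\<lambda>u x. indicator {h x..h x + 1} u :: real"
  show "pos_def (\<lambda>x y. of_real (?i u x * ?i u y) * A x y)" for u
    by (rule pos_def_feature[OF A])
  fix x y
  let ?l = "max (h x) (h y)" and ?r = "min (h x) (h y) + 1"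
  have "((\<lambda>u. A x y) has_integral measure lborel (cbox ?l ?r) *\<^sub>R A x y) (cbox ?l ?r)"
    by (rule has_integral_const)
  then have "((\<lambda>u. if u \<in> cbox ?l ?r then A x y else 0) has_integral
      measure lborel (cbox ?l ?r) *\<^sub>R A x y) UNIV"
    by (simp only: has_integral_restrict_UNIV)
  moreover have "(\<lambda>u. if u \<in> cbox ?l ?r then A x y else 0) = (\<lambda>u. of_real (?i u x * ?i u y) * A x y)"
    by (auto simp: fun_eq_iff indicator_def)
  moreover have "measure lborel (cbox ?l ?r) = max 0 (1 - \<bar>h x - h y\<bar>)"
    by (auto simp: measure_lborel_Icc max_def min_def)
  ultimately show "((\<lambda>u. of_real (?i u x * ?i u y) * A x y) has_integral
      of_real (max 0 (1 - \<bar>h x - h y\<bar>)) * A x y) UNIV"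
    by (simp add: scaleR_conv_of_real)
qed

text \<open>With \<open>r = \<bar>h x - h y\<bar>\<close>, the function \<open>exp (- r)\<close> is the limit of \<open>(1 - r / n)\<^sup>n\<close>, and for \<open>n \<ge> r\<close> this is
  the \<open>n\<close>-th power of a triangle function.\<close>

lemma pos_def_exp:
  fixes h :: "'x \<Rightarrow> real"
  assumes A: "pos_def A"
  shows "pos_def (\<lambda>x y. of_real (exp (- \<bar>h x - h y\<bar>)) * A x y)"
proof (rule pos_def_limit[where F = sequentially])
  let ?t = "\<lambda>n x y. max 0 (1 - \<bar>h x / real n - h y / real n\<bar>)"
  have "pos_def (\<lambda>x y. of_real (?t n x y ^ m) * A x y)" for n m
    by (induction m) (use A pos_def_triangle in \<open>auto simp: mult.assoc\<close>)
  then show "pos_def (\<lambda>x y. of_real (?t n x y ^ n) * A x y)" for n .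
  fix x y
  let ?d = "\<bar>h x - h y\<bar>"
  have "\<forall>\<^sub>F n in sequentially. max ?d 1 \<le> real n"
    using filterlim_real_sequentially unfolding filterlim_at_top by blast
  then have eq: "\<forall>\<^sub>F n in sequentially. (1 + (- ?d) / real n) ^ n = ?t n x y ^ n"
  proof eventually_elim
    case (elim n)
    then have "?d / real n \<le> 1" by simp
    then show ?case
      by (simp add: diff_divide_distrib[symmetric])
  qed
  have "(\<lambda>n. (1 + (- ?d) / real n) ^ n) \<longlonglongrightarrow> exp (- ?d)"
    by (rule tendsto_exp_limit_sequentially)
  then have "(\<lambda>n. ?t n x y ^ n) \<longlonglongrightarrow> exp (- ?d)"
    by (rule Lim_transform_eventually[OF _ eq])
  then show "(\<lambda>n. of_real (?t n x y ^ n) * A x y) \<longlonglongrightarrow> of_real (exp (- ?d)) * A x y"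
    by (intro tendsto_intros)
qed simp

lemma pos_def_exp_suminf:
  fixes h :: "nat \<Rightarrow> 'x \<Rightarrow> real"
  assumes "\<And>x y. summable (\<lambda>n. \<bar>h n x - h n y\<bar>)"
  shows "pos_def (\<lambda>x y. of_real (exp (- (\<Sum>n. \<bar>h n x - h n y\<bar>))))"
proof (rule pos_def_limit[where F = sequentially])
  show "pos_def (\<lambda>x y. of_real (exp (- (\<Sum>n<N. \<bar>h n x - h n y\<bar>))))" for N
  proof (induction N)
    case 0
    show ?case using pos_def_one by simp
  next
    case (Suc N)
    show ?case
      using pos_def_exp[OF Suc, of "h N"] by (simp add: exp_add[symmetric] algebra_simps flip: of_real_mult)
  qed
  show "(\<lambda>N. complex_of_real (exp (- (\<Sum>n<N. \<bar>h n x - h n y\<bar>)))) \<longlonglongrightarrow>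
      complex_of_real (exp (- (\<Sum>n. \<bar>h n x - h n y\<bar>)))" for x y
    by (intro tendsto_intros summable_LIMSEQ assms)
qed simp

section \<open>The unitary group\<close>

lemma cring_complex_ring: "cring complex_ring"
proof (rule cringI)
  show "abelian_group complex_ring"
    by (rule abelian_groupI) (auto simp: complex_ring_def algebra_simps intro: exI[of _ "- x" for x])
  show "comm_monoid complex_ring"
    by (rule comm_monoidI) (auto simp: complex_ring_def)
qed (auto simp: complex_ring_def algebra_simps)

lemma unitary_group_sel:
  "carrier (unitary_group H) \<subseteq> Bij (carrier H)"
  "f \<in> Bij (carrier H) \<Longrightarrow> g \<in> Bij (carrier H) \<Longrightarrow> mult (unitary_group H) f g = compose (carrier H) f g"
  "one (unitary_group H) = (\<lambda>x\<in>carrier H. x)"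
  by (auto simp: unitary_group_def BijGroup_def)

lemma monoid_unitary_group:
  assumes "hilbert_space H" shows "monoid (unitary_group H)"
proof -
  interpret hilbert_space H by fact
  interpret B: group "BijGroup (carrier H)" by (rule group_BijGroup)
  have [simp]: "carrier (BijGroup (carrier H)) = Bij (carrier H)" by (simp add: BijGroup_def)
  have Bij: "f x \<in> carrier H" if "f \<in> Bij (carrier H)" "x \<in> carrier H" for f x
    using that by (auto simp: Bij_def bij_betw_def)
  have smult: "a \<odot>\<^bsub>H\<^esub> x \<in> carrier H" if "x \<in> carrier H" for a x
    using smult_closed[of a x] that by (simp add: complex_ring_def)
  show ?thesis
  proof (rule monoidI)
    fix f g assume fg: "f \<in> carrier (unitary_group H)" "g \<in> carrier (unitary_group H)"
    then have B: "f \<in> Bij (carrier H)" "g \<in> Bij (carrier H)" by (auto simp: unitary_group_def)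
    have "compose (carrier H) f g \<in> carrier (unitary_group H)"
      using fg Bij[OF B(1)] Bij[OF B(2)] compose_Bij[OF B]
      by (simp add: unitary_group_def compose_def smult)
    then show "f \<otimes>\<^bsub>unitary_group H\<^esub> g \<in> carrier (unitary_group H)"
      by (simp add: unitary_group_sel B)
  next
    show "\<one>\<^bsub>unitary_group H\<^esub> \<in> carrier (unitary_group H)"
      using B.one_closed by (simp add: unitary_group_def BijGroup_def smult)
  next
    fix f g h assume "f \<in> carrier (unitary_group H)" "g \<in> carrier (unitary_group H)" "h \<in> carrier (unitary_group H)"
    then show "f \<otimes>\<^bsub>unitary_group H\<^esub> g \<otimes>\<^bsub>unitary_group H\<^esub> h = f \<otimes>\<^bsub>unitary_group H\<^esub> (g \<otimes>\<^bsub>unitary_group H\<^esub> h)"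
      using B.m_assoc[of f g h] by (auto simp: unitary_group_def)
  next
    fix f assume "f \<in> carrier (unitary_group H)"
    then show "\<one>\<^bsub>unitary_group H\<^esub> \<otimes>\<^bsub>unitary_group H\<^esub> f = f" "f \<otimes>\<^bsub>unitary_group H\<^esub> \<one>\<^bsub>unitary_group H\<^esub> = f"
      using B.l_one[of f] B.r_one[of f] by (auto simp: unitary_group_def)
  qed
qed

section \<open>Unitary operators induced by symmetries of a kernel\<close>

context pd_kernel
begin

definition hilbert_rkhs :: "('x \<Rightarrow> complex) inner_space" where
  "hilbert_rkhs = \<lparr>carrier = rkhs, mult = (\<lambda>F G. F), one = (\<lambda>_. 0), zero = (\<lambda>_. 0),
     add = (\<lambda>F G x. F x + G x), smult = (\<lambda>a F x. a * F x), ip = rkhs_inner\<rparr>"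

lemma hilbert_rkhs_sel [simp]:
  "carrier hilbert_rkhs = rkhs" "zero hilbert_rkhs = (\<lambda>_. 0)" "add hilbert_rkhs F G = (\<lambda>x. F x + G x)"
  "smult hilbert_rkhs a F = (\<lambda>x. a * F x)" "ip hilbert_rkhs = rkhs_inner"
  by (simp_all add: hilbert_rkhs_def)

lemma abelian_group_hilbert_rkhs: "abelian_group hilbert_rkhs"
proof (rule abelian_groupI)
  fix F assume "F \<in> carrier hilbert_rkhs"
  then show "\<exists>G\<in>carrier hilbert_rkhs. G \<oplus>\<^bsub>hilbert_rkhs\<^esub> F = \<zero>\<^bsub>hilbert_rkhs\<^esub>"
    using rkhs_mult[of F "- 1"] by (intro bexI[of _ "\<lambda>x. - F x"]) auto
qed (auto simp: rkhs_add rkhs_zero algebra_simps)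

lemma module_hilbert_rkhs: "Module.module complex_ring hilbert_rkhs"
  by (rule Module.moduleI[OF cring_complex_ring abelian_group_hilbert_rkhs])
     (auto simp: rkhs_mult complex_ring_def algebra_simps)

lemma pre_hilbert_space_hilbert_rkhs: "pre_hilbert_space hilbert_rkhs"
proof (rule pre_hilbert_space.intro[OF module_hilbert_rkhs], unfold_locales)
  fix F assume F: "F \<in> carrier hilbert_rkhs" "ip hilbert_rkhs F F = 0"
  then show "F = \<zero>\<^bsub>hilbert_rkhs\<^esub>" using rkhs_norm_eq_0[of F] by (simp add: rkhs_norm_def)
qed (simp_all add: rkhs_inner_add rkhs_inner_mult rkhs_inner_nonneg rkhs_inner_cnj[symmetric] del: complex_cnj_cancel_iff)

lemma hilbert_rkhs_minus:
  assumes "F \<in> rkhs" "G \<in> rkhs" shows "F \<ominus>\<^bsub>hilbert_rkhs\<^esub> G = (\<lambda>x. F x - G x)"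
proof -
  interpret abelian_group hilbert_rkhs by (rule abelian_group_hilbert_rkhs)
  have "\<ominus>\<^bsub>hilbert_rkhs\<^esub> G = (\<lambda>x. - G x)"
    using rkhs_mult[OF assms(2), of "- 1"] assms by (intro minus_equality) auto
  then show ?thesis by (simp add: a_minus_def)
qed

lemma hdist_hilbert_rkhs: "F \<in> rkhs \<Longrightarrow> G \<in> rkhs \<Longrightarrow> hdist hilbert_rkhs F G = rkhs_norm (\<lambda>x. F x - G x)"
  by (simp add: hdist_def rkhs_norm_def hilbert_rkhs_minus)

lemma rkhs_norm_triangle:
  assumes "F \<in> rkhs" "G \<in> rkhs" shows "rkhs_norm (\<lambda>x. F x + G x) \<le> rkhs_norm F + rkhs_norm G"
  by (rule rkhs_norm_le[OF bounded_by_add[OF bounded_by_rkhs_norm bounded_by_rkhs_norm]]) (use assms in auto)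

lemma rkhs_norm_minus_commute:
  assumes "F \<in> rkhs" "G \<in> rkhs" shows "rkhs_norm (\<lambda>x. F x - G x) = rkhs_norm (\<lambda>x. G x - F x)"
  by (rule antisym; rule rkhs_norm_le[OF bounded_by_minus_commute[OF bounded_by_rkhs_norm[OF rkhs_diff]]]) (use assms in auto)

lemma Metric_space_hilbert_rkhs: "Metric_space rkhs (hdist hilbert_rkhs)"
proof
  fix F G
  show "0 \<le> hdist hilbert_rkhs F G"
    by (cases "F \<in> rkhs \<and> G \<in> rkhs")
       (auto simp: hdist_hilbert_rkhs rkhs_norm_nonneg rkhs_diff, auto simp: hdist_def)
  show "hdist hilbert_rkhs F G = hdist hilbert_rkhs G F"
    by (cases "F \<in> rkhs \<and> G \<in> rkhs")
       (auto simp: hdist_hilbert_rkhs rkhs_norm_minus_commute[of F G], auto simp: hdist_def)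
next
  fix F G assume FG: "F \<in> rkhs" "G \<in> rkhs"
  show "hdist hilbert_rkhs F G = 0 \<longleftrightarrow> F = G"
  proof
    assume "hdist hilbert_rkhs F G = 0"
    then show "F = G"
      using rkhs_norm_eq_0[OF rkhs_diff[OF FG]] FG by (auto simp: hdist_hilbert_rkhs fun_eq_iff)
  next
    assume "F = G"
    then show "hdist hilbert_rkhs F G = 0"
      using FG rkhs_norm_le[of 0 "\<lambda>_. 0"] rkhs_norm_nonneg[OF rkhs_zero] by (simp add: hdist_hilbert_rkhs bounded_by_def)
  qed
next
  fix F G K assume "F \<in> rkhs" "G \<in> rkhs" "K \<in> rkhs"
  then show "hdist hilbert_rkhs F K \<le> hdist hilbert_rkhs F G + hdist hilbert_rkhs G K"
    using rkhs_norm_triangle[of "\<lambda>x. F x - G x" "\<lambda>x. G x - K x"]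
    by (simp add: hdist_hilbert_rkhs rkhs_diff)
qed

lemma hilbert_space_hilbert_rkhs: "hilbert_space hilbert_rkhs"
proof (rule hilbert_space.intro[OF pre_hilbert_space_hilbert_rkhs], unfold_locales)
  interpret Metric_space rkhs "hdist hilbert_rkhs" by (rule Metric_space_hilbert_rkhs)
  show "Metric_space.mcomplete (carrier hilbert_rkhs) (hdist hilbert_rkhs)"
    unfolding hilbert_rkhs_sel mcomplete_def
  proof (intro allI impI)
    fix F :: "nat \<Rightarrow> 'x \<Rightarrow> complex" assume C: "MCauchy F"
    have F: "F n \<in> rkhs" for n using C by (auto simp: MCauchy_def)
    have "\<exists>G\<in>rkhs. \<forall>r>0. \<exists>N. \<forall>n\<ge>N. rkhs_norm (\<lambda>x. F n x - G x) < r"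
    proof (rule rkhs_complete[OF F])
      fix r :: real assume "0 < r"
      then show "\<exists>N. \<forall>m\<ge>N. \<forall>n\<ge>N. rkhs_norm (\<lambda>x. F m x - F n x) < r"
        using C F unfolding MCauchy_def by (metis hdist_hilbert_rkhs)
    qed
    then obtain G where G: "G \<in> rkhs" "\<And>r. r > 0 \<Longrightarrow> \<exists>N. \<forall>n\<ge>N. rkhs_norm (\<lambda>x. F n x - G x) < r"
      by blast
    then show "\<exists>G. limitin mtopology F G sequentially"
      using F by (auto simp: limitin_metric eventually_sequentially hdist_hilbert_rkhs intro!: exI[of _ G])
  qed
qed

definition push_comb :: "('x \<Rightarrow> 'x) \<Rightarrow> (complex \<times> 'x) list \<Rightarrow> (complex \<times> 'x) list" where
  "push_comb s c = map (\<lambda>(a, x). (a, s x)) c"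

lemma push_simps [simp]: "push_comb s [] = []" "push_comb s (p # c) = (fst p, s (snd p)) # push_comb s c"
  by (simp_all add: push_comb_def split_beta)

lemma eval_push: "eval_comb F (push_comb s c) = eval_comb (\<lambda>x. F (s x)) c"
  by (induction c) simp_all

definition inv_sriant :: "('x \<Rightarrow> 'x) \<Rightarrow> bool" where
  "inv_sriant s \<longleftrightarrow> bij s \<and> (\<forall>x y. k (s x) (s y) = k x y)"

lemma inv_sriant_inv: "inv_sriant s \<Longrightarrow> inv_sriant (inv_into UNIV s)"
  unfolding inv_sriant_def by (metis bij_imp_bij_inv bij_inv_eq_iff)

lemma kernel_comb_push:
  assumes "inv_sriant s" shows "kernel_comb k (push_comb s c) (s x) = kernel_comb k c x"
  using assms by (induction c) (simp_all add: inv_sriant_def)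

lemma gram_push:
  assumes "inv_sriant s" shows "gram k (push_comb s c) (push_comb s d) = gram k c d"
  by (simp add: gram_def eval_push kernel_comb_push[OF assms])

lemma comb_norm_push: "inv_sriant s \<Longrightarrow> comb_norm (push_comb s c) = comb_norm c"
  by (simp add: comb_norm_def gram_push)

lemma bounded_by_compose: "inv_sriant s \<Longrightarrow> bounded_by M F \<Longrightarrow> bounded_by M (\<lambda>x. F (s x))"
  unfolding bounded_by_def eval_push[symmetric] by (metis comb_norm_push)

lemma rkhs_compose: "inv_sriant s \<Longrightarrow> F \<in> rkhs \<Longrightarrow> (\<lambda>x. F (s x)) \<in> rkhs"
  unfolding rkhs_def using bounded_by_compose by blast

lemma kernel_comb_compose:
  assumes "inv_sriant s" shows "kernel_comb k c (s x) = kernel_comb k (push_comb (inv_into UNIV s) c) x"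
  using kernel_comb_push[OF inv_sriant_inv[OF assms], of c "s x"] assms
  by (simp add: inv_sriant_def bij_is_inj)

text \<open>Composition with \<open>s\<close> carries the kernel function of a combination to that of its image under the inverse of
  \<open>s\<close>, so an approximating sequence for \<open>G\<close> yields one for \<open>G \<circ> s\<close>.\<close>

lemma rkhs_inner_compose:
  assumes s: "inv_sriant s" and F: "F \<in> rkhs" and G: "G \<in> rkhs"
  shows "rkhs_inner (\<lambda>x. F (s x)) (\<lambda>x. G (s x)) = rkhs_inner F G"
proof -
  obtain c where c: "approximated_by G c" using approximated_by_exists[OF G] by blast
  then have "approximated_by (\<lambda>x. G (s x)) (\<lambda>n. push_comb (inv_into UNIV s) (c n))"
    unfolding approximated_by_def kernel_comb_compose[OF s, symmetric] using bounded_by_compose[OF s] by fast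
  from rkhs_inner_limit[OF rkhs_compose[OF s F] this]
  have "(\<lambda>n. eval_comb F (c n)) \<longlonglongrightarrow> rkhs_inner (\<lambda>x. F (s x)) (\<lambda>x. G (s x))"
    using s by (simp add: eval_push inv_sriant_def bij_is_surj surj_f_inv_f)
  then show ?thesis using rkhs_inner_limit[OF F c] by (rule LIMSEQ_unique)
qed

definition comp_op :: "('x \<Rightarrow> 'x) \<Rightarrow> ('x \<Rightarrow> complex) \<Rightarrow> ('x \<Rightarrow> complex)" where
  "comp_op s = restrict (\<lambda>F x. F (s x)) rkhs"

lemma comp_op_Bij: assumes s: "inv_sriant s" shows "comp_op s \<in> Bij rkhs"
proof -
  have "bij_betw (comp_op s) rkhs rkhs"
    by (rule bij_betwI[where g = "comp_op (inv_into UNIV s)"])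
       (use s rkhs_compose[OF s] rkhs_compose[OF inv_sriant_inv[OF s]] in
         \<open>auto simp: comp_op_def inv_sriant_def bij_is_inj bij_is_surj surj_f_inv_f\<close>)
  then show ?thesis by (simp add: Bij_def comp_op_def)
qed

lemma comp_op_unitary: "inv_sriant s \<Longrightarrow> comp_op s \<in> carrier (unitary_group hilbert_rkhs)"
  by (simp add: unitary_group_def comp_op_Bij) (simp add: comp_op_def rkhs_add rkhs_mult rkhs_inner_compose)

lemma comp_op_mult:
  assumes "inv_sriant s" "inv_sriant t"
  shows "comp_op s \<otimes>\<^bsub>unitary_group hilbert_rkhs\<^esub> comp_op t = comp_op (\<lambda>x. t (s x))"
  using assms comp_op_Bij
  by (auto simp: unitary_group_sel compose_def comp_op_def fun_eq_iff rkhs_compose)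

text \<open>As the operators are isometric, it suffices by density to treat kernel functions. For these the squared
  distance of two images is \<open>2 \<parallel>c\<parallel>\<^sup>2 - 2 h g\<close>, where \<open>h g\<close> is a finite sum of values of the kernel.\<close>

lemma continuous_comp_op:
  assumes inv_s: "\<And>f. f \<in> topspace T \<Longrightarrow> inv_sriant (s f)"
    and cont: "\<And>x y. continuous_map T euclidean (\<lambda>f. k (s f x) y)"
    and F: "F \<in> rkhs"
  shows "continuous_map T (hilbert_topology hilbert_rkhs) (\<lambda>f. comp_op (s f) F)"
proof -
  interpret Metric_space rkhs "hdist hilbert_rkhs" by (rule Metric_space_hilbert_rkhs)
  have "\<exists>U. openin T U \<and> f \<in> U \<and> (\<forall>g\<in>U. comp_op (s g) F \<in> mball (comp_op (s f) F) r)"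
    if f: "f \<in> topspace T" and r: "0 < r" for f r
  proof -
    obtain c where c: "bounded_by (r / 8) (\<lambda>x. F x - kernel_comb k c x)" using approx[OF F, of "r / 8"] r by auto
    let ?c = "\<lambda>g. push_comb (inv_into UNIV (s g)) c"
    define h where "h g = Re (gram k (push_comb (s g) (?c f)) c)" for g
    have "continuous_map T euclidean (\<lambda>g. eval_comb (kernel_comb k c) (push_comb (s g) d))" for d
    proof -
      have k: "continuous_map T euclidean (\<lambda>g. kernel_comb k c (s g x))" for x
        using cont unfolding continuous_map_atin limitin_canonical_iff
        by (induction c) (auto intro!: tendsto_intros)
      show ?thesis
        using k unfolding continuous_map_atin limitin_canonical_iff
        by (induction d) (auto intro!: tendsto_intros)
    qed
    then have "continuous_map T euclidean h"
      unfolding h_def gram_def continuous_map_atin limitin_canonical_iff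
      by (auto intro!: tendsto_intros)
    then have "openin T {g \<in> topspace T. h g \<in> {h f - r\<^sup>2 / 8 <..}}"
      by (rule openin_continuous_map_preimage) simp
    moreover have "comp_op (s g) F \<in> mball (comp_op (s f) F) r"
      if g: "g \<in> topspace T" "h f - r\<^sup>2 / 8 < h g" for g
    proof -
      have sg: "inv_sriant (s g)" and sf: "inv_sriant (s f)" using inv_s f g by auto
      have hg: "Re (gram k (?c f) (?c g)) = h g" if "g \<in> topspace T" for g
      proof -
        have "push_comb (s g) (?c g) = c"
          using inv_s[OF that] by (induction c) (simp_all add: inv_sriant_def bij_is_surj surj_f_inv_f)
        then show ?thesis
          using gram_push[OF inv_s[OF that], of "?c f" "?c g"] by (simp add: h_def)
      qed
      have "(comb_norm (?c f @ scale_comb (- 1) (?c g)))\<^sup>2 = 2 * (comb_norm c)\<^sup>2 - 2 * h g"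
        using hg[OF g(1)] by (simp add: comb_norm_append_sq comb_norm_scale comb_norm_push inv_sriant_inv sf sg)
      moreover have "h f = (comb_norm c)\<^sup>2"
        using hg[OF f] comb_norm_push[OF inv_sriant_inv[OF sf], of c] by (simp add: comb_norm_sq[symmetric])
      ultimately have "(comb_norm (?c f @ scale_comb (- 1) (?c g)))\<^sup>2 \<le> (r / 2)\<^sup>2"
        using g(2) by (simp add: power_divide)
      then have "comb_norm (?c f @ scale_comb (- 1) (?c g)) \<le> r / 2"
        by (rule power2_le_imp_le) (use r in simp)
      then have "bounded_by (r / 2) (kernel_comb k (?c f @ scale_comb (- 1) (?c g)))"
        by (rule bounded_by_mono[OF bounded_by_kernel_comb])
      then have 1: "bounded_by (r / 2) (\<lambda>x. kernel_comb k c (s f x) - kernel_comb k c (s g x))"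
        by (simp add: kernel_comb_diff kernel_comb_compose sf sg)
      have "bounded_by (r / 8 + r / 8 + r / 2) (\<lambda>x. F (s f x) - F (s g x))"
        using bounded_by_add[OF bounded_by_diff[OF bounded_by_compose[OF sf c] bounded_by_compose[OF sg c]] 1]
        by (simp add: algebra_simps)
      from rkhs_norm_le[OF this] have "rkhs_norm (\<lambda>x. F (s f x) - F (s g x)) < r"
        using r by simp
      then show ?thesis
        using F by (simp add: comp_op_def hdist_hilbert_rkhs rkhs_compose sf sg)
    qed
    ultimately show ?thesis
      using f r by (intro exI[of _ "{g \<in> topspace T. h g \<in> {h f - r\<^sup>2 / 8 <..}}"]) auto
  qed
  then show ?thesis
    using continuous_map_to_metric unfolding hilbert_topology_def hilbert_rkhs_sel by blast
qed

end

section \<open>The unitary representation\<close>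

definition polar :: "'a::real_normed_vector set \<Rightarrow> ('a \<Rightarrow>\<^sub>L real) set" where
  "polar K = {f. \<forall>x\<in>K. \<bar>blinfun_apply f x\<bar> \<le> 1}"

text \<open>On pairs of an index and a functional, the kernel that is \<open>exp (- l1_seminorm (z i) (f - g))\<close> for equal indices
  \<open>i\<close> and 0 otherwise is positive definite, and translations of the second component preserve it. Its Hilbert
  space is the orthogonal sum over \<open>i\<close> of the cyclic representations with these positive definite functions, and
  it consists of complex functions on pairs. The displacement of the cyclic vector in the \<open>i\<close>-th summand
  measures \<open>l1_seminorm (z i)\<close>, which gives the continuity of the inverse.\<close>

lemma unitarily_representable_of_summing_family:
  fixes z :: "('a::real_normed_vector \<Rightarrow>\<^sub>L real) set \<Rightarrow> nat \<Rightarrow> 'a"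
  assumes z: "\<And>i. summing (z i)"
    and dom: "\<And>K. compact K \<Longrightarrow> \<exists>i. \<forall>f. l1_seminorm (z i) f < 1 \<longrightarrow> f \<in> polar K"
  shows "unitarily_representable (additive_group :: ('a \<Rightarrow>\<^sub>L real) monoid) tau_k"
proof -
  define h :: "nat \<Rightarrow> ('a \<Rightarrow>\<^sub>L real) set \<times> ('a \<Rightarrow>\<^sub>L real) \<Rightarrow> real" where
    "h n x = blinfun_apply (snd x) (z (fst x) n)" for n x
  define k where "k x y = (if fst x = fst y then complex_of_real (exp (- (\<Sum>n. \<bar>h n x - h n y\<bar>))) else 0)" for x y
  have k_eq: "k (i, f) (j, g) = (if i = j then complex_of_real (exp (- l1_seminorm (z i) (f - g))) else 0)" for i j f g
    by (simp add: k_def h_def l1_seminorm_def blinfun.diff_left)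
  have "summable (\<lambda>n. \<bar>h n x - h n y\<bar>)" for x y
    by (rule summable_comparison_test'[OF summable_add[OF summingD[OF z, of "snd x" "fst x"] summingD[OF z, of "snd y" "fst y"]]])
       (simp add: h_def)
  then have "pos_def k"
    unfolding k_def by (intro pos_def_blocks pos_def_exp_suminf)
  then interpret pd_kernel k by (rule pd_kernel.intro)
  define s :: "('a \<Rightarrow>\<^sub>L real) \<Rightarrow> ('a \<Rightarrow>\<^sub>L real) set \<times> ('a \<Rightarrow>\<^sub>L real) \<Rightarrow> _" where
    "s f x = (fst x, snd x + f)" for f x
  have inv_s: "inv_sriant (s f)" for f
  proof -
    have "bij (s f)"
      by (rule bij_betw_byWitness[where f' = "s (- f)"]) (auto simp: s_def)
    then show ?thesis by (auto simp: inv_sriant_def s_def k_eq)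
  qed
  have cont_k: "continuous_map tau_k euclidean (\<lambda>f. k (s f x) y)" for x y
  proof -
    obtain i g j g' where xy: "x = (i, g)" "y = (j, g')" by fastforce
    have "continuous_map tau_k euclidean (\<lambda>f. complex_of_real (exp (- l1_seminorm (z i) (f + (g - g')))))"
      using continuous_l1_seminorm[OF z[of i], of "g - g'"]
      unfolding continuous_map_atin limitin_canonical_iff by (auto intro!: tendsto_intros)
    then show ?thesis
      by (cases "i = j") (simp_all add: xy s_def k_eq algebra_simps)
  qed
  let ?\<phi> = "\<lambda>f. comp_op (s f)"
  have "isomorphic_to_subgroup_of (additive_group :: ('a \<Rightarrow>\<^sub>L real) monoid) tau_k
      (unitary_group hilbert_rkhs) (strong_topology hilbert_rkhs)"
  proof (rule tau_k_embeddingI[where \<phi> = ?\<phi>])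
    show "monoid (unitary_group hilbert_rkhs)"
      by (rule monoid_unitary_group[OF hilbert_space_hilbert_rkhs])
    show unitary: "?\<phi> f \<in> carrier (unitary_group hilbert_rkhs)" for f
      by (rule comp_op_unitary[OF inv_s])
    have "s (f + g) = (\<lambda>x. s g (s f x))" for f g by (simp add: s_def fun_eq_iff add_ac)
    then show "?\<phi> (f + g) = ?\<phi> f \<otimes>\<^bsub>unitary_group hilbert_rkhs\<^esub> ?\<phi> g" for f g
      by (simp add: comp_op_mult inv_s)
    show "?\<phi> 0 = \<one>\<^bsub>unitary_group hilbert_rkhs\<^esub>"
      by (simp add: unitary_group_sel comp_op_def s_def)
    have ext: "?\<phi> f \<in> extensional rkhs" for f by (simp add: comp_op_def)
    show cont: "continuous_map tau_k (strong_topology hilbert_rkhs) ?\<phi>"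
      unfolding strong_topology_def continuous_map_in_subtopology continuous_map_componentwise
      using unitary ext continuous_comp_op[OF inv_s cont_k] by auto
    fix K :: "'a set" and f :: "'a \<Rightarrow>\<^sub>L real" assume "compact K"
    then obtain i where i: "\<And>g. l1_seminorm (z i) g < 1 \<Longrightarrow> g \<in> polar K" using dom by blast
    define F where "F = kernel_comb k [(1, (i, 0))]"
    have F: "F \<in> rkhs" by (simp add: F_def rkhs_kernel_comb)
    interpret M: Metric_space rkhs "hdist hilbert_rkhs" by (rule Metric_space_hilbert_rkhs)
    let ?T = "strong_topology hilbert_rkhs"
    let ?V = "{u \<in> topspace ?T. u F \<in> M.mball (?\<phi> f F) (1 - exp (- 1))}"
    have \<phi>F: "?\<phi> g F \<in> rkhs" "?\<phi> g F = (\<lambda>x. F (s g x))" for g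
      using rkhs_compose[OF inv_s F] F by (auto simp: comp_op_def)
    have "continuous_map ?T (hilbert_topology hilbert_rkhs) (\<lambda>u. u F)"
      unfolding strong_topology_def
      by (intro continuous_map_from_subtopology continuous_map_product_projection) (simp add: F)
    then have "openin ?T ?V"
      by (rule openin_continuous_map_preimage) (simp add: hilbert_topology_def)
    moreover have in_T: "?\<phi> g \<in> topspace ?T" for g
      using continuous_map_image_subset_topspace[OF cont] by auto
    then have "?\<phi> f \<in> ?V" using \<phi>F(1) by simp
    moreover have "\<bar>blinfun_apply g x - blinfun_apply f x\<bar> \<le> 1" if g: "?\<phi> g \<in> ?V" and x: "x \<in> K" for g :: "'a \<Rightarrow>\<^sub>L real" and x
    proof -
      \<comment> \<open>The displacement is bounded below by its value at one point, as the kernel is 1 on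
        the diagonal; \<open>(i, - f)\<close> is where the translate of \<open>F\<close> by \<open>f\<close> takes its maximum 1.\<close>
      let ?d = "\<lambda>x. F (s f x) - F (s g x)" and ?p = "(i, - f)"
      have "rkhs_norm ?d < 1 - exp (- 1)"
        using g \<phi>F by (simp add: hdist_hilbert_rkhs)
      moreover have "cmod (?d ?p) \<le> rkhs_norm ?d"
      proof -
        have "?d \<in> rkhs" using \<phi>F(1)[of f] \<phi>F(1)[of g] unfolding \<phi>F(2) by (rule rkhs_diff)
        moreover have "comb_norm [(1, ?p)] = 1" by (simp add: comb_norm_def gram_Cons_left k_eq l1_seminorm_def)
        ultimately show ?thesis using bdD[OF bounded_by_rkhs_norm, of ?d "[(1, ?p)]"] by simp
      qed
      moreover have eq: "?d ?p = complex_of_real (1 - exp (- l1_seminorm (z i) (g - f)))"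
        by (simp add: F_def s_def k_eq) (simp add: l1_seminorm_def)
      ultimately have "1 - exp (- l1_seminorm (z i) (g - f)) < 1 - exp (- 1)"
        unfolding eq norm_of_real by linarith
      then have "g - f \<in> polar K" by (intro i) simp
      then show ?thesis using x by (auto simp: polar_def blinfun.diff_left)
    qed
    ultimately show "\<exists>V. openin ?T V \<and> ?\<phi> f \<in> V \<and> (\<forall>g :: 'a \<Rightarrow>\<^sub>L real. ?\<phi> g \<in> V \<longrightarrow> (\<forall>x\<in>K. \<bar>blinfun_apply g x - blinfun_apply f x\<bar> \<le> 1))"
      by blast
  qed
  then show ?thesis
    unfolding unitarily_representable_def using hilbert_space_hilbert_rkhs by blast
qed

text \<open>The polars of compact sets serve as indices, because they are sets of functionals. Compact sets with the
  same polar may share a sequence, as the polar is all that the topology sees; an index that is not a polar gets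
  the zero sequence.\<close>

lemma unitarily_representable_tau_k:
  assumes "script_L_infty TYPE('a::real_normed_vector)"
  shows "unitarily_representable (additive_group :: ('a \<Rightarrow>\<^sub>L real) monoid) tau_k"
proof -
  have ex: "\<exists>z. summing z \<and> (\<forall>K. compact K \<and> polar K = i \<longrightarrow> (\<forall>f. l1_seminorm z f < 1 \<longrightarrow> f \<in> i))"
    for i :: "('a \<Rightarrow>\<^sub>L real) set"
  proof (cases "\<exists>K :: 'a set. compact K \<and> polar K = i")
    case True
    then obtain K :: "'a set" where K: "compact K" "polar K = i" by blast
    obtain z where z: "summing z" "\<And>f x. x \<in> K \<Longrightarrow> \<bar>blinfun_apply f x\<bar> \<le> l1_seminorm z f"
      using compact_dominated_by_summing_sequence[OF assms K(1)] by blast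
    have "f \<in> i" if "l1_seminorm z f < 1" for f
      unfolding K(2)[symmetric] polar_def using z(2)[of _ f] that by (auto intro: order_trans less_imp_le)
    with z(1) show ?thesis by blast
  next
    case False
    with summing_zero show ?thesis by blast
  qed
  have "\<exists>z. \<forall>i :: ('a \<Rightarrow>\<^sub>L real) set. summing (z i) \<and>
      (\<forall>K. compact K \<and> polar K = i \<longrightarrow> (\<forall>f. l1_seminorm (z i) f < 1 \<longrightarrow> f \<in> i))"
    by (rule choice[OF allI[OF ex]])
  then obtain z where z: "\<And>i :: ('a \<Rightarrow>\<^sub>L real) set. summing (z i) \<and>
      (\<forall>K. compact K \<and> polar K = i \<longrightarrow> (\<forall>f. l1_seminorm (z i) f < 1 \<longrightarrow> f \<in> i))"
    by blast
  show ?thesis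
    by (rule unitarily_representable_of_summing_family[where z = z]) (use z in blast)+
qed

theorem theorem3p3:
  assumes "script_L_infty TYPE('a::banach)"
  shows "(\<exists>I :: 'a set set.
            isomorphic_to_subgroup_of
              (additive_group :: ('a \<Rightarrow>\<^sub>L real) monoid) tau_k
              (product_group I (\<lambda>_. additive_group :: ell1 monoid))
              (product_topology (\<lambda>_. euclidean) I))
       \<and> unitarily_representable (additive_group :: ('a \<Rightarrow>\<^sub>L real) monoid) tau_k"
  using tau_k_embeds_ell1_power[OF assms] unitarily_representable_tau_k[OF assms] by blast

end
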